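(* Let $d,e\in\mathbb{R}\setminus\{0\}$ with $|d|\le|e|$ and $d\neq e$, and for $\theta\in\mathbb{R}$ consider the planar system $$\frac{dx}{dt}=y,\qquad \frac{dy}{dt}=-(x^{2}-\theta)\,y-\frac{x(x+d)(x+e)}{de}.$$ Then the equilibrium point $E_0=(0,0)$ is unstable if $\theta>0$ and stable if $\theta\le 0$. Moreover, for all values of $\theta$ near $\theta=0$ for which $E_0$ is a source, the system has a stable limit cycle; that is, there exists $\varepsilon>0$ (depending on $d,e$) such that for every $\theta\in(-\varepsilon,\varepsilon)$ for which $E_0$ is a source the system has a stable limit cycle.
   Context: The system is the first-order form of the modified van der Pol equation $\frac{d^{2}x}{dt^{2}}+(x^{2}-\theta)\frac{dx}{dt}+\frac{x(x+d)(x+e)}{de}=0$. The parameters $d,e$ are fixed and $\theta$ is the bifurcation parameter. An equilibrium is a source if all eigenvalues of the Jacobian matrix of the vector field there have positive real part. Stability of an equilibrium is understood in the usual sense for the flow in the plane. A limit cycle is an isolated nonconstant periodic orbit, and it is stable if nearby orbits converge to it as $t\to+\infty$. *)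

theory Defs
  imports "HOL-Analysis.Analysis"
begin

definition vdp_field :: "real \<Rightarrow> real \<Rightarrow> real \<Rightarrow> real^2 \<Rightarrow> real^2" where
  "vdp_field d e \<theta> z =
     vector [z $ 2,
             - ((z $ 1)^2 - \<theta>) * z $ 2 - (z $ 1) * (z $ 1 + d) * (z $ 1 + e) / (d * e)]"

definition solves_on :: "('a::real_normed_vector \<Rightarrow> 'a) \<Rightarrow> (real \<Rightarrow> 'a) \<Rightarrow> real set \<Rightarrow> bool" where
  "solves_on f \<gamma> J \<longleftrightarrow> (\<forall>t\<in>J. (\<gamma> has_vector_derivative f (\<gamma> t)) (at t within J))"

text \<open>The vector fields considered need not be forward complete (solutions may escape to infinity
  in finite time), so the stability notions below demand explicitly that solutions starting nearby
  exist for all positive time. For a locally Lipschitz field a forward solution is unique on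
  \<open>{0..}\<close>, so ``some'' and ``every'' forward solution mean the same when one exists.\<close>

definition forward_solution ::
    "('a::real_normed_vector \<Rightarrow> 'a) \<Rightarrow> 'a \<Rightarrow> (real \<Rightarrow> 'a) \<Rightarrow> bool" where
  "forward_solution f q \<gamma> \<longleftrightarrow> \<gamma> 0 = q \<and> solves_on f \<gamma> {0..}"

definition equilibrium :: "('a::real_normed_vector \<Rightarrow> 'a) \<Rightarrow> 'a \<Rightarrow> bool" where
  "equilibrium f p \<longleftrightarrow> f p = 0"

text \<open>Stability of equilibria is stability in the sense of Lyapunov.\<close>

definition lyapunov_stable :: "('a::real_normed_vector \<Rightarrow> 'a) \<Rightarrow> 'a \<Rightarrow> bool" where
  "lyapunov_stable f p \<longleftrightarrow>
     (\<forall>\<epsilon>>0. \<exists>\<delta>>0. \<forall>q. dist q p < \<delta> \<longrightarrow>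
        (\<exists>\<gamma>. forward_solution f q \<gamma>) \<and>
        (\<forall>\<gamma>. forward_solution f q \<gamma> \<longrightarrow> (\<forall>t\<ge>0. dist (\<gamma> t) p < \<epsilon>)))"

definition stable_equilibrium :: "('a::real_normed_vector \<Rightarrow> 'a) \<Rightarrow> 'a \<Rightarrow> bool" where
  "stable_equilibrium f p \<longleftrightarrow> equilibrium f p \<and> lyapunov_stable f p"

definition unstable_equilibrium :: "('a::real_normed_vector \<Rightarrow> 'a) \<Rightarrow> 'a \<Rightarrow> bool" where
  "unstable_equilibrium f p \<longleftrightarrow> equilibrium f p \<and> \<not> lyapunov_stable f p"

definition complex_eigenvalue :: "real^'n^'n \<Rightarrow> complex \<Rightarrow> bool" where
  "complex_eigenvalue A \<mu> \<longleftrightarrow>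
     (\<exists>v::complex^'n. v \<noteq> 0 \<and> map_matrix complex_of_real A *v v = \<mu> *s v)"

definition source :: "(real^'n \<Rightarrow> real^'n) \<Rightarrow> real^'n \<Rightarrow> bool" where
  "source f p \<longleftrightarrow> equilibrium f p \<and> f differentiable (at p) \<and>
     (\<forall>\<mu>. complex_eigenvalue (jacobian f (at p)) \<mu> \<longrightarrow> Re \<mu> > 0)"

definition periodic_orbit :: "('a::real_normed_vector \<Rightarrow> 'a) \<Rightarrow> 'a set \<Rightarrow> bool" where
  "periodic_orbit f \<Gamma> \<longleftrightarrow>
     (\<exists>\<gamma> T. solves_on f \<gamma> UNIV \<and> T > 0 \<and> (\<forall>t. \<gamma> (t + T) = \<gamma> t) \<and>
            (\<exists>s t. \<gamma> s \<noteq> \<gamma> t) \<and> \<Gamma> = range \<gamma>)"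

text \<open>Isolated: some neighbourhood of the orbit is met by no other periodic orbit.\<close>

definition limit_cycle :: "('a::real_normed_vector \<Rightarrow> 'a) \<Rightarrow> 'a set \<Rightarrow> bool" where
  "limit_cycle f \<Gamma> \<longleftrightarrow> periodic_orbit f \<Gamma> \<and>
     (\<exists>\<delta>>0. \<forall>\<Gamma>'. periodic_orbit f \<Gamma>' \<and> (\<exists>q\<in>\<Gamma>'. infdist q \<Gamma> < \<delta>) \<longrightarrow> \<Gamma>' = \<Gamma>)"

definition stable_limit_cycle :: "('a::real_normed_vector \<Rightarrow> 'a) \<Rightarrow> 'a set \<Rightarrow> bool" where
  "stable_limit_cycle f \<Gamma> \<longleftrightarrow> limit_cycle f \<Gamma> \<and>
     (\<exists>\<delta>>0. \<forall>q. infdist q \<Gamma> < \<delta> \<longrightarrow>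
        (\<exists>\<gamma>. forward_solution f q \<gamma>) \<and>
        (\<forall>\<gamma>. forward_solution f q \<gamma> \<longrightarrow> ((\<lambda>t. infdist (\<gamma> t) \<Gamma>) \<longlongrightarrow> 0) at_top))"

end

(*
  For theta <= 0 the energy H = y^2/2 + G(x), with G' the restoring force, satisfies
  H' = (theta - x^2) y^2 <= 0 and is positive definite at the origin; for theta > 0 the function
  H - c x y with a small c > 0 grows exponentially near the origin.

  For theta = m^2 > 0 small, rescale by m and use polar coordinates with the angle p as time. The
  energy with a corrector removing the oscillating part of its production is a function V(p, r)
  with dV/dp = m^2 (r^2/2 - r^4/8 + O(m)), uniformly in C^1 on 3/2 <= r <= 3. Hence an annulus around
  r = 2 is invariant, and two solutions compared at the same angle satisfy
  |V(p, r_1) - V(p, r_2)| <= exp(- k p) const. The return map is a contraction in the coordinate V,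
  so there is a periodic orbit, and it attracts a neighbourhood; attraction forces it to be isolated.
*)

theory Submission
  imports Defs
begin

section \<open>Global solutions and uniqueness for ordinary differential equations\<close>

text \<open>The quadratic and cubic parts of the restoring force are conservative: they change the
  energy but not its production \<open>(1 - X\<^sup>2) * Y\<^sup>2\<close>. The averaged rate r^2/2
  - r^4/8 is therefore the same for all d and e, and its sign change from plus to minus at r = 2
  makes the cycle attracting. The obstacle is that the raw production is not decreasing in r at each
  fixed angle (near cos p = 0 it behaves like r^2), so contraction would be visible only after a
  whole turn, through the derivative of the return map. The corrector makes the rate decrease in r
  at every single angle, and a Gronwall estimate for two solutions is enough. Taking the angle as
  time makes this estimate scalar and removes the neutral direction along the orbit. Closeness in r
  of first order is required because the contraction rate is itself only of order m^2. The
  polynomial field need not have global solutions. Each equation is therefore truncated to a bounded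
  Lipschitz one and solved on the whole line, and a trapping argument shows that the truncation is
  never felt.\<close>

lemma antiderivative_exists:
  fixes h :: "real \<Rightarrow> 'a::euclidean_space"
  assumes "continuous_on UNIV h"
  shows "\<exists>g. g 0 = 0 \<and> (\<forall>t. (g has_vector_derivative h t) (at t))"
proof -
  have "\<exists>F. \<forall>x :: real. -\<infinity> < ereal x \<longrightarrow> ereal x < \<infinity> \<longrightarrow> (F has_vector_derivative h x) (at x)"
    using assms by (intro einterval_antiderivative) (auto simp: continuous_on_eq_continuous_at)
  then obtain F where F: "\<And>x. (F has_vector_derivative h x) (at x)" by auto
  have "((\<lambda>t. F t - F 0) has_vector_derivative h t) (at t)" for t
    using has_vector_derivative_diff[OF F has_vector_derivative_const] by simp
  then show ?thesis by (intro exI[of _ "\<lambda>t. F t - F 0"]) simp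
qed

text \<open>Integrating C exp(k s) from 0 gains the factor 1/k; this gain is what makes the integral
  operator contract for large k. Negative times follow by reflection.\<close>

lemma antiderivative_exp_bound:
  fixes g :: "real \<Rightarrow> 'a::real_normed_vector"
  assumes g0: "g 0 = 0" and g': "\<And>t. (g has_vector_derivative h t) (at t)"
    and h: "\<And>t. norm (h t) \<le> C * exp (k * \<bar>t\<bar>)" and k: "k > 0"
  shows "norm (g t) \<le> C / k * exp (k * \<bar>t\<bar>)"
proof -
  have C: "C \<ge> 0" using order_trans[OF norm_ge_zero h[of 0]] by simp
  have pos: "norm (g t) \<le> C / k * exp (k * t)"
    if "t > 0" "g 0 = 0" "\<And>t. (g has_vector_derivative h t) (at t)"
       "\<And>t. norm (h t) \<le> C * exp (k * \<bar>t\<bar>)" for t and g h :: "real \<Rightarrow> 'a"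
  proof -
    have "norm (g t - g 0) \<le> C / k * exp (k * t) - C / k * exp (k * 0)"
    proof (rule differentiable_bound_general[OF that(1), where f' = h and \<phi>' = "\<lambda>s. C * exp (k * s)"])
      show "continuous_on {0..t} g"
        using that(3) by (meson continuous_at_imp_continuous_on has_vector_derivative_continuous)
      show "continuous_on {0..t} (\<lambda>a. C / k * exp (k * a))" by (intro continuous_intros)
      show "((\<lambda>a. C / k * exp (k * a)) has_vector_derivative C * exp (k * x)) (at x)" for x
        unfolding has_real_derivative_iff_has_vector_derivative[symmetric]
        using k by (auto intro!: derivative_eq_intros)
      show "norm (h x) \<le> C * exp (k * x)" if "0 < x" for x
        using \<open>\<And>t. norm (h t) \<le> C * exp (k * \<bar>t\<bar>)\<close>[of x] that by simp
    qed (use that in auto)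
    moreover have "C / k * exp (k * 0) \<ge> 0" using C k by simp
    ultimately show ?thesis using that by simp
  qed
  consider "t > 0" | "t = 0" | "t < 0" by linarith
  then show ?thesis
  proof cases
    case 1 then show ?thesis using pos[OF 1 g0 g' h] by simp
  next
    case 2 then show ?thesis using C k g0 by simp
  next
    case 3
    have "((\<lambda>t. g (- t)) has_vector_derivative - h (- t)) (at t)" for t
    proof -
      have "((g \<circ> uminus) has_vector_derivative (-1) *\<^sub>R h (- t)) (at t)"
        by (rule vector_diff_chain_at) (auto intro!: derivative_eq_intros g')
      then show ?thesis by (simp add: o_def)
    qed
    from pos[OF _ _ this, of "- t"] 3 g0 show ?thesis using h[of "- s" for s] by simp
  qed
qed

text \<open>Picard iteration in Bielecki's weighted norm: with weight \<open>exp (- 2 L \<bar>t\<bar>)\<close> the integral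
  operator is a contraction on the whole line at once, so no continuation argument is needed.\<close>

lemma picard_global:
  fixes f :: "real \<Rightarrow> 'a::euclidean_space \<Rightarrow> 'a"
  assumes cont: "continuous_on UNIV (\<lambda>(t, x). f t x)"
    and lip: "\<And>t x y. norm (f t x - f t y) \<le> L * norm (x - y)"
    and bd: "\<And>t x. norm (f t x) \<le> B"
  shows "\<exists>u. u 0 = x0 \<and> (\<forall>t. (u has_vector_derivative f t (u t)) (at t))"
proof -
  \<comment> \<open>The factor 2 gives \<open>L / k \<le> 1/2\<close>, the contraction constant; the
    \<open>+ 1\<close> keeps \<open>k\<close> positive even for \<open>L = 0\<close>.\<close>
  define k where "k = 2 * (\<bar>L\<bar> + 1)"
  have k: "k > 0" by (simp add: k_def add_pos_nonneg)
  have B: "B \<ge> 0" using bd[of 0 0] norm_ge_zero[of "f 0 0"] by linarith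
  define w where "w t = exp (k * \<bar>t\<bar>)" for t :: real
  have w1: "w t \<ge> 1" for t using k by (simp add: w_def)
  have wpos: "w t > 0" for t by (simp add: w_def)
  have wcont: "continuous_on S w" for S unfolding w_def by (intro continuous_intros)
  define A where "A h = (SOME g. g 0 = 0 \<and> (\<forall>t. (g has_vector_derivative h t) (at t)))"
    for h :: "real \<Rightarrow> 'a"
  have A: "A h 0 = 0 \<and> (\<forall>t. (A h has_vector_derivative h t) (at t))" if "continuous_on UNIV h" for h
    unfolding A_def using someI_ex[OF antiderivative_exists[OF that]] .
  \<comment> \<open>A bounded continuous \<open>u\<close> stands for the possibly unbounded function
    \<open>w t *\<^sub>R u t\<close>; \<open>T\<close> divides by the weight again.\<close>
  define rhs where "rhs u t = f t (w t *\<^sub>R apply_bcontfun u t)" for u :: "real \<Rightarrow>\<^sub>C 'a" and t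
  have rhs_cont: "continuous_on UNIV (rhs u)" for u
  proof -
    have "continuous_on UNIV ((\<lambda>(t, x). f t x) \<circ> (\<lambda>t. (t, w t *\<^sub>R apply_bcontfun u t)))"
      by (rule continuous_on_compose)
        (auto intro!: continuous_intros wcont continuous_on_subset[OF cont])
    then show ?thesis by (simp add: o_def rhs_def[abs_def])
  qed
  note A' = A[OF rhs_cont]
  have Acont: "continuous_on UNIV (A (rhs u))" for u
    using A'[of u] by (meson continuous_at_imp_continuous_on has_vector_derivative_continuous)
  define T where "T u t = (1 / w t) *\<^sub>R (x0 + A (rhs u) t)" for u t
  have Abound: "norm (A (rhs u) t) \<le> B / k * w t" for u t
    unfolding w_def
  proof (rule antiderivative_exp_bound[where h = "rhs u"])
    show "norm (rhs u s) \<le> B * exp (k * \<bar>s\<bar>)" for s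
      using bd[of s "w s *\<^sub>R apply_bcontfun u s"] w1[of s] mult_left_mono[OF w1[of s] B] unfolding rhs_def w_def
      by linarith
  qed (use A' k in auto)
  have TB: "norm (T u t) \<le> norm x0 + B / k" for u t
  proof -
    have "norm (T u t) = norm (x0 + A (rhs u) t) / w t"
      using wpos[of t] by (simp add: T_def)
    also have "\<dots> \<le> (norm x0 + B / k * w t) / w t"
      using Abound[of u t] norm_triangle_ineq[of x0 "A (rhs u) t"] wpos[of t]
      by (intro divide_right_mono) auto
    also have "\<dots> = norm x0 / w t + B / k" using wpos[of t] by (simp add: field_simps)
    also have "\<dots> \<le> norm x0 + B / k"
      using divide_left_mono[OF w1[of t], of "norm x0"] wpos[of t] by auto
    finally show ?thesis .
  qed
  have TC: "T u \<in> bcontfun" for u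
  proof (rule bcontfun_normI[OF _ TB])
    show "continuous_on UNIV (T u)" unfolding T_def
      using wpos by (intro continuous_intros wcont Acont) (auto simp: less_imp_neq[symmetric])
  qed
  define TT where "TT u = Bcontfun (T u)" for u
  have TT: "apply_bcontfun (TT u) t = T u t" for u t
    unfolding TT_def using Bcontfun_inverse[OF TC[of u]] by simp
  have contr: "dist (TT u) (TT v) \<le> (1/2) * dist u v" for u v
  proof (rule dist_bound)
    fix t
    have "norm (A (rhs u) t - A (rhs v) t) \<le> (L * dist u v) / k * exp (k * \<bar>t\<bar>)"
    proof (rule antiderivative_exp_bound[where h = "\<lambda>t. rhs u t - rhs v t"])
      show "((\<lambda>t. A (rhs u) t - A (rhs v) t) has_vector_derivative rhs u s - rhs v s) (at s)" for s
        using A' by (intro has_vector_derivative_diff) auto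
      show "norm (rhs u s - rhs v s) \<le> L * dist u v * exp (k * \<bar>s\<bar>)" for s
      proof -
        have L: "L \<ge> 0"
        proof -
          obtain x :: 'a where "x \<in> Basis" using nonempty_Basis by blast
          then show ?thesis using order_trans[OF norm_ge_zero lip[of 0 x 0]] by simp
        qed
        have "norm (rhs u s - rhs v s) \<le> L * norm (w s *\<^sub>R apply_bcontfun u s - w s *\<^sub>R apply_bcontfun v s)"
          unfolding rhs_def by (rule lip)
        also have "\<dots> = L * (w s * dist (apply_bcontfun u s) (apply_bcontfun v s))"
          using wpos[of s] by (simp add: dist_norm flip: scaleR_diff_right)
        also have "\<dots> \<le> L * (w s * dist u v)"
          using wpos[of s] L by (intro mult_left_mono dist_bounded) auto
        finally show ?thesis by (simp add: w_def mult_ac)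
      qed
    qed (use A' k in auto)
    also have "L * dist u v / k * exp (k * \<bar>t\<bar>) \<le> (1/2) * dist u v * w t"
    proof -
      have "L / k \<le> 1/2" using k by (simp add: k_def field_simps)
      then have "L / k * (dist u v * w t) \<le> 1/2 * (dist u v * w t)"
        using wpos[of t] by (intro mult_right_mono) auto
      then show ?thesis by (simp add: w_def)
    qed
    finally have *: "norm (A (rhs u) t - A (rhs v) t) \<le> (1/2) * dist u v * w t" .
    have "dist (T u t) (T v t) = norm (A (rhs u) t - A (rhs v) t) / w t"
      using wpos[of t] by (simp add: T_def dist_norm flip: scaleR_diff_right)
    also have "\<dots> \<le> (1/2) * dist u v" using * wpos[of t] by (simp add: field_simps)
    finally show "dist (apply_bcontfun (TT u) t) (apply_bcontfun (TT v) t) \<le> (1/2) * dist u v"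
      by (simp add: TT)
  qed
  obtain u where u: "TT u = u"
    using banach_fix_type[of "1/2" TT] contr by auto
  define y where "y t = w t *\<^sub>R apply_bcontfun u t" for t
  have y: "y t = x0 + A (rhs u) t" for t
    using TT[of u t] wpos[of t] unfolding u y_def T_def by simp
  have "y 0 = x0" using A' y by simp
  moreover have "(y has_vector_derivative f t (y t)) (at t)" for t
  proof -
    have "(y has_vector_derivative rhs u t) (at t)"
      unfolding y[abs_def] using has_vector_derivative_add[OF has_vector_derivative_const, of "A (rhs u)"] A'[of u]
      by simp
    then show ?thesis by (simp add: rhs_def y_def)
  qed
  ultimately show ?thesis by blast
qed

text \<open>Gronwall in monotone form: exp(-2 L t) |u - v|^2 does not increase. The square keeps it
  differentiable, derivatives within the interval admit forward solutions, and the Lipschitz bound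
  is asked only along the two curves, so a local constant suffices.\<close>

lemma ode_unique_interval:
  fixes u v :: "real \<Rightarrow> 'a::real_inner"
  assumes u: "\<And>t. t \<in> {a..b} \<Longrightarrow> (u has_vector_derivative u' t) (at t within {a..b})"
    and v: "\<And>t. t \<in> {a..b} \<Longrightarrow> (v has_vector_derivative v' t) (at t within {a..b})"
    and lip: "\<And>t. t \<in> {a..b} \<Longrightarrow> norm (u' t - v' t) \<le> L * norm (u t - v t)"
    and "u a = v a" and t: "t \<in> {a..b}"
  shows "u t = v t"
proof -
  define w where "w t = exp (- (2 * L) * t) * ((u t - v t) \<bullet> (u t - v t))" for t
  define w' where "w' t = exp (- (2 * L) * t) * (2 * ((u t - v t) \<bullet> (u' t - v' t)))
      - 2 * L * exp (- (2 * L) * t) * ((u t - v t) \<bullet> (u t - v t))" for t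
  have uv: "((\<lambda>t. u t - v t) has_vector_derivative u' t - v' t) (at t within {a..b})" if "t \<in> {a..b}" for t
    using that by (intro has_vector_derivative_diff u v)
  have w: "(w has_real_derivative w' t) (at t within {a..b})" if "t \<in> {a..b}" for t
  proof -
    have "((\<lambda>t. (u t - v t) \<bullet> (u t - v t)) has_vector_derivative
        ((u t - v t) \<bullet> (u' t - v' t) + (u' t - v' t) \<bullet> (u t - v t))) (at t within {a..b})"
      using bounded_bilinear.has_vector_derivative[OF bounded_bilinear_inner uv[OF that] uv[OF that]] .
    then have D: "((\<lambda>t. (u t - v t) \<bullet> (u t - v t)) has_real_derivative
        (2 * ((u t - v t) \<bullet> (u' t - v' t)))) (at t within {a..b})"
      by (simp only: has_real_derivative_iff_has_vector_derivative inner_commute mult_2)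
    have "((\<lambda>t. exp (- (2 * L) * t) * ((u t - v t) \<bullet> (u t - v t))) has_real_derivative
        exp (- (2 * L) * t) * (- (2 * L)) * ((u t - v t) \<bullet> (u t - v t))
        + 2 * ((u t - v t) \<bullet> (u' t - v' t)) * exp (- (2 * L) * t)) (at t within {a..b})"
      by (rule DERIV_mult[OF _ D]) (auto intro!: derivative_eq_intros)
    then show ?thesis unfolding w_def w'_def by (simp add: mult_ac)
  qed
  have w'le: "w' t \<le> 0" if "t \<in> {a..b}" for t
  proof -
    have "(u t - v t) \<bullet> (u' t - v' t) \<le> norm (u t - v t) * norm (u' t - v' t)"
      by (rule norm_cauchy_schwarz)
    also have "\<dots> \<le> norm (u t - v t) * (L * norm (u t - v t))"
      by (intro mult_left_mono lip that) auto
    also have "\<dots> = L * ((u t - v t) \<bullet> (u t - v t))"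
      by (simp add: power2_norm_eq_inner[symmetric] power2_eq_square)
    finally have "exp (- (2 * L) * t) * (2 * ((u t - v t) \<bullet> (u' t - v' t)))
        \<le> exp (- (2 * L) * t) * (2 * (L * ((u t - v t) \<bullet> (u t - v t))))"
      by (intro mult_left_mono) auto
    then show ?thesis by (simp add: w'_def algebra_simps)
  qed
  have cont: "continuous_on {a..b} w"
    using w by (rule DERIV_continuous_on)
  have "w a \<ge> w t"
  proof (rule DERIV_nonpos_imp_decreasing_open[of _ _ w])
    show "a \<le> t" using t by simp
    show "continuous_on {a..t} w"
      using t by (intro continuous_on_subset[OF cont]) auto
    fix x assume "a < x" "x < t"
    then have x: "x \<in> {a..b}" "at x within {a..b} = at x" using t by (auto simp: at_within_Icc_at)
    show "\<exists>y. (w has_real_derivative y) (at x) \<and> y \<le> 0"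
      using w[OF x(1)] w'le[OF x(1)] x(2) by auto
  qed
  then have "exp (- (2 * L) * t) * ((u t - v t) \<bullet> (u t - v t)) \<le> 0"
    using \<open>u a = v a\<close> by (simp add: w_def)
  then have "(u t - v t) \<bullet> (u t - v t) \<le> 0"
    by (simp add: mult_le_0_iff)
  then show ?thesis using inner_ge_zero[of "u t - v t"] by simp
qed

lemma ode_unique_line:
  fixes u v :: "real \<Rightarrow> 'a::real_inner"
  assumes u: "\<And>t. (u has_vector_derivative u' t) (at t)"
    and v: "\<And>t. (v has_vector_derivative v' t) (at t)"
    and lip: "\<And>t. norm (u' t - v' t) \<le> L * norm (u t - v t)"
    and a: "u a = v a"
  shows "u t = v t"
proof (cases "a \<le> t")
  case True
  show ?thesis
    by (rule ode_unique_interval[of a t u u' v v' L])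
      (use True u v lip a in \<open>auto intro: has_vector_derivative_at_within\<close>)
next
  case False
  have rev: "((\<lambda>s. w (- s)) has_vector_derivative - w' (- s)) (at s within S)"
    if "\<And>t. (w has_vector_derivative w' t) (at t)" for w w' :: "real \<Rightarrow> 'a" and s S
  proof -
    have "((w \<circ> uminus) has_vector_derivative (-1) *\<^sub>R w' (- s)) (at s)"
      by (rule vector_diff_chain_at) (auto intro!: derivative_eq_intros that)
    then show ?thesis by (simp add: o_def has_vector_derivative_at_within)
  qed
  have "(\<lambda>s. u (- s)) (- t) = (\<lambda>s. v (- s)) (- t)"
    by (rule ode_unique_interval[of "- a" "- t" _ "\<lambda>s. - u' (- s)" _ "\<lambda>s. - v' (- s)" L])
      (use False a lip in \<open>auto intro!: rev u v simp: norm_minus_commute\<close>)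
  then show ?thesis by simp
qed

section \<open>Bounded Lipschitz functions and barrier arguments\<close>

text \<open>Boundedness is included because products of Lipschitz functions are Lipschitz only when
  the factors are bounded. The class is then closed under the operations that build the truncated
  fields, so their regularity follows rule by rule without computing derivatives.\<close>

definition bounded_lipschitz :: "('a::metric_space \<Rightarrow> real) \<Rightarrow> bool" where
  "bounded_lipschitz f \<longleftrightarrow>
     (\<exists>C\<ge>0. \<forall>x y. \<bar>f x\<bar> \<le> C \<and> \<bar>f x - f y\<bar> \<le> C * dist x y)"

lemma bounded_lipschitzI:
  assumes "\<And>x. \<bar>f x\<bar> \<le> B" "\<And>x y. \<bar>f x - f y\<bar> \<le> L * dist x y"
  shows "bounded_lipschitz f"
  unfolding bounded_lipschitz_def
proof (intro exI[of _ "max \<bar>B\<bar> \<bar>L\<bar>"] conjI allI)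
  fix x y
  show "\<bar>f x\<bar> \<le> max \<bar>B\<bar> \<bar>L\<bar>" using assms(1)[of x] by linarith
  have "L * dist x y \<le> max \<bar>B\<bar> \<bar>L\<bar> * dist x y" by (intro mult_right_mono) auto
  then show "\<bar>f x - f y\<bar> \<le> max \<bar>B\<bar> \<bar>L\<bar> * dist x y" using assms(2)[of x y] by linarith
qed auto

lemma bounded_lipschitzE:
  assumes "bounded_lipschitz f"
  obtains C where "C \<ge> 0" "\<And>x. \<bar>f x\<bar> \<le> C" "\<And>x y. \<bar>f x - f y\<bar> \<le> C * dist x y"
  using assms unfolding bounded_lipschitz_def by blast

named_theorems bl_intros

lemma bounded_lipschitz_const [bl_intros]: "bounded_lipschitz (\<lambda>x. c)"
  by (rule bounded_lipschitzI[of _ "\<bar>c\<bar>" 0]) auto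

lemma bounded_lipschitz_add [bl_intros]:
  assumes "bounded_lipschitz f" "bounded_lipschitz g"
  shows "bounded_lipschitz (\<lambda>x. f x + g x)"
proof -
  obtain C where C: "C \<ge> 0" "\<And>x. \<bar>f x\<bar> \<le> C" "\<And>x y. \<bar>f x - f y\<bar> \<le> C * dist x y"
    using assms(1) unfolding bounded_lipschitz_def by blast
  obtain D where D: "D \<ge> 0" "\<And>x. \<bar>g x\<bar> \<le> D" "\<And>x y. \<bar>g x - g y\<bar> \<le> D * dist x y"
    using assms(2) unfolding bounded_lipschitz_def by blast
  show ?thesis
  proof (rule bounded_lipschitzI)
    fix x y
    show "\<bar>f x + g x\<bar> \<le> C + D" using C(2)[of x] D(2)[of x] by linarith
    show "\<bar>f x + g x - (f y + g y)\<bar> \<le> (C + D) * dist x y"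
      using C(3)[of x y] D(3)[of x y] unfolding distrib_right by linarith
  qed
qed

lemma bounded_lipschitz_mult [bl_intros]:
  assumes "bounded_lipschitz f" "bounded_lipschitz g"
  shows "bounded_lipschitz (\<lambda>x. f x * g x)"
proof -
  obtain C where C: "C \<ge> 0" "\<And>x. \<bar>f x\<bar> \<le> C" "\<And>x y. \<bar>f x - f y\<bar> \<le> C * dist x y"
    using assms(1) unfolding bounded_lipschitz_def by blast
  obtain D where D: "D \<ge> 0" "\<And>x. \<bar>g x\<bar> \<le> D" "\<And>x y. \<bar>g x - g y\<bar> \<le> D * dist x y"
    using assms(2) unfolding bounded_lipschitz_def by blast
  show ?thesis
  proof (rule bounded_lipschitzI)
    fix x y
    show "\<bar>f x * g x\<bar> \<le> C * D" unfolding abs_mult using C D by (intro mult_mono) auto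
    have "f x * g x - f y * g y = f x * (g x - g y) + (f x - f y) * g y" by (simp add: algebra_simps)
    then have "\<bar>f x * g x - f y * g y\<bar> \<le> \<bar>f x\<bar> * \<bar>g x - g y\<bar> + \<bar>f x - f y\<bar> * \<bar>g y\<bar>"
      using abs_triangle_ineq[of "f x * (g x - g y)" "(f x - f y) * g y"] by (simp only: abs_mult)
    also have "\<dots> \<le> C * (D * dist x y) + (C * dist x y) * D"
      using C D by (intro add_mono mult_mono) auto
    finally show "\<bar>f x * g x - f y * g y\<bar> \<le> (2 * C * D) * dist x y" by (simp add: algebra_simps)
  qed
qed

lemma bounded_lipschitz_minus [bl_intros]:
  "bounded_lipschitz f \<Longrightarrow> bounded_lipschitz (\<lambda>x. - f x)"
  using bounded_lipschitz_mult[OF bounded_lipschitz_const[of "-1"]] by simp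

lemma bounded_lipschitz_diff [bl_intros]:
  "bounded_lipschitz f \<Longrightarrow> bounded_lipschitz g \<Longrightarrow> bounded_lipschitz (\<lambda>x. f x - g x)"
  using bounded_lipschitz_add[OF _ bounded_lipschitz_minus] by simp

lemma bounded_lipschitz_power [bl_intros]:
  "bounded_lipschitz f \<Longrightarrow> bounded_lipschitz (\<lambda>x. f x ^ n)"
  by (induction n) (simp_all add: bounded_lipschitz_const bounded_lipschitz_mult)

lemma bounded_lipschitz_divide_const [bl_intros]:
  "bounded_lipschitz f \<Longrightarrow> bounded_lipschitz (\<lambda>x. f x / c)"
  using bounded_lipschitz_mult[OF _ bounded_lipschitz_const[of "1 / c"]] by simp

lemma bounded_lipschitz_divide_half:
  assumes "bounded_lipschitz f" "bounded_lipschitz g" "\<And>x. g x \<ge> 1/2"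
  shows "bounded_lipschitz (\<lambda>x. f x / g x)"
proof -
  obtain D where D: "D \<ge> 0" "\<And>x. \<bar>g x\<bar> \<le> D" "\<And>x y. \<bar>g x - g y\<bar> \<le> D * dist x y"
    using assms(2) unfolding bounded_lipschitz_def by blast
  have pos: "g x > 0" for x using assms(3)[of x] by linarith
  have "bounded_lipschitz (\<lambda>x. 1 / g x)"
  proof (rule bounded_lipschitzI)
    fix x y
    show "\<bar>1 / g x\<bar> \<le> 2" using assms(3)[of x] pos[of x] by (simp add: field_simps)
    have "1 / g x - 1 / g y = (g y - g x) / (g x * g y)"
      using pos[of x] pos[of y] by (simp add: field_simps)
    then have "\<bar>1 / g x - 1 / g y\<bar> = \<bar>g x - g y\<bar> / (g x * g y)"
      using pos[of x] pos[of y] by (simp add: abs_mult)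
    also have "\<dots> \<le> (D * dist x y) / (1 / 4)"
    proof (rule frac_le)
      show "1 / 4 \<le> g x * g y" using mult_mono[OF assms(3)[of x] assms(3)[of y]] pos[of x] by simp
    qed (use D in auto)
    finally show "\<bar>1 / g x - 1 / g y\<bar> \<le> (4 * D) * dist x y" by simp
  qed
  from bounded_lipschitz_mult[OF assms(1) this] show ?thesis by simp
qed

lemma bounded_lipschitz_clamp:
  assumes "\<And>x y. \<bar>f x - f y\<bar> \<le> L * dist x y"
  shows "bounded_lipschitz (\<lambda>x. max (p::real) (min q (f x)))"
proof (rule bounded_lipschitzI)
  fix x y
  show "\<bar>max p (min q (f x))\<bar> \<le> \<bar>p\<bar> + \<bar>q\<bar>" by linarith
  show "\<bar>max p (min q (f x)) - max p (min q (f y))\<bar> \<le> L * dist x y" using assms[of x y] by linarith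
qed

lemma abs_cos_diff_le: "\<bar>cos x - cos y\<bar> \<le> \<bar>x - y\<bar>" for x y :: real
proof -
  have "cos x - cos y = 2 * (sin ((x + y) / 2) * sin ((y - x) / 2))" by (rule cos_diff_cos[THEN trans]) simp
  then have "\<bar>cos x - cos y\<bar> = 2 * (\<bar>sin ((x + y) / 2)\<bar> * \<bar>sin ((y - x) / 2)\<bar>)" by (simp add: abs_mult)
  also have "\<dots> \<le> 2 * (1 * \<bar>(y - x) / 2\<bar>)"
    by (intro mult_left_mono mult_mono abs_sin_x_le_abs_x abs_sin_le_one) auto
  finally show ?thesis by simp
qed

lemma abs_sin_diff_le: "\<bar>sin x - sin y\<bar> \<le> \<bar>x - y\<bar>" for x y :: real
  using abs_cos_diff_le[of "pi/2 - x" "pi/2 - y"] by (simp add: cos_diff)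

lemma bounded_lipschitz_cos:
  assumes "\<And>x y. \<bar>f x - f y\<bar> \<le> L * dist x y"
  shows "bounded_lipschitz (\<lambda>x. cos (f x))"
  using order_trans[OF abs_cos_diff_le assms] by (intro bounded_lipschitzI[of _ 1]) auto

lemma bounded_lipschitz_sin:
  assumes "\<And>x y. \<bar>f x - f y\<bar> \<le> L * dist x y"
  shows "bounded_lipschitz (\<lambda>x. sin (f x))"
  using order_trans[OF abs_sin_diff_le assms] by (intro bounded_lipschitzI[of _ 1]) auto

lemma bounded_lipschitz_continuous:
  assumes "bounded_lipschitz f"
  shows "continuous_on S f"
proof -
  obtain C where C: "C \<ge> 0" "\<And>x. \<bar>f x\<bar> \<le> C" "\<And>x y. \<bar>f x - f y\<bar> \<le> C * dist x y"
    using assms unfolding bounded_lipschitz_def by blast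
  then have "C-lipschitz_on S f" by (auto simp: lipschitz_on_def dist_real_def)
  then show ?thesis by (rule lipschitz_on_continuous_on)
qed

text \<open>At the first time when \<open>n\<close> equals \<open>c\<close> the weak inequality
  holds up to that time, and \<open>step\<close> makes it strict there, a contradiction. This is the
  form in which a priori estimates are closed below.\<close>

lemma continuity_bootstrap:
  fixes n :: "real \<Rightarrow> real"
  assumes cont: "continuous_on {a..} n" and n0: "n a < c"
    and step: "\<And>t. t \<ge> a \<Longrightarrow> (\<And>s. s \<in> {a..t} \<Longrightarrow> n s \<le> c) \<Longrightarrow> n t < c"
    and t: "t \<ge> a"
  shows "n t < c"
proof (rule ccontr)
  assume "\<not> n t < c"
  have cont': "continuous_on {a..s} n" for s by (rule continuous_on_subset[OF cont]) auto
  have "n a \<le> c" using n0 by simp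
  note ivt = IVT'[OF this _ _ cont']
  have "\<exists>s\<ge>a. s \<le> t \<and> n s = c"
  proof -
    have "c \<le> n t" using \<open>\<not> n t < c\<close> by simp
    from ivt[OF this t] show ?thesis by simp
  qed
  define S where "S = {s \<in> {a..t}. n s = c}"
  have ne: "S \<noteq> {}" using \<open>\<exists>s\<ge>a. s \<le> t \<and> n s = c\<close> by (auto simp: S_def)
  have "closed S" unfolding S_def
    by (intro continuous_closed_preimage_constant cont') auto
  moreover have "bdd_below S" by (auto simp: S_def)
  ultimately have Inf: "Inf S \<in> S" using ne closed_contains_Inf by blast
  have "n s \<le> c" if "s \<in> {a..Inf S}" for s
  proof (rule ccontr)
    assume s: "\<not> n s \<le> c"
    have "c \<le> n s" "a \<le> s" using s that by auto
    from ivt[OF this] obtain u where u: "u \<ge> a" "u \<le> s" "n u = c" by blast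
    have "u \<noteq> s" using s u(3) by auto
    then have "u < s" using u(2) by simp
    moreover have "u \<in> S" using u that Inf by (auto simp: S_def)
    ultimately show False using cInf_lower[OF \<open>u \<in> S\<close> \<open>bdd_below S\<close>] that by simp
  qed
  then have "n (Inf S) < c" using Inf by (intro step) (auto simp: S_def)
  then show False using Inf by (auto simp: S_def)
qed

text \<open>After the last time with \<open>v \<le> c\<close> the function lies above
  \<open>c\<close>, where its derivative is nonpositive, so it cannot have risen. Passing to the
  last time allows a sign condition that is not strict.\<close>

lemma upper_barrier:
  fixes v :: "real \<Rightarrow> real"
  assumes v: "\<And>s. s \<in> {a..t} \<Longrightarrow> (v has_real_derivative v' s) (at s)"
    and neg: "\<And>s. s \<in> {a..t} \<Longrightarrow> v s \<ge> c \<Longrightarrow> v' s \<le> 0"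
    and va: "v a \<le> c" and t: "a \<le> t"
  shows "v t \<le> c"
proof (rule ccontr)
  assume c: "\<not> v t \<le> c"
  have cont: "continuous_on {a..t} v" using v by (meson DERIV_isCont continuous_at_imp_continuous_on)
  define S where "S = {a..t} \<inter> v -` {..c}"
  have ne: "a \<in> S" using va t by (auto simp: S_def)
  have "closed S" unfolding S_def
    using cont by (intro continuous_closed_preimage) auto
  moreover have bdd: "bdd_above S" by (auto simp: S_def)
  ultimately have Sup: "Sup S \<in> S" using ne closed_contains_Sup by blast
  have gt: "v s > c" if "Sup S < s" "s \<le> t" for s
  proof (rule ccontr)
    assume "\<not> v s > c"
    then have "s \<in> S" using that Sup by (auto simp: S_def)
    then show False using cSup_upper[OF _ bdd] that by (meson not_le)
  qed
  have "v (Sup S) \<ge> v t"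
  proof (rule DERIV_nonpos_imp_decreasing_open[of _ _ v])
    show "Sup S \<le> t" using Sup by (auto simp: S_def)
    show "continuous_on {Sup S..t} v" by (rule continuous_on_subset[OF cont]) (use Sup in \<open>auto simp: S_def\<close>)
    fix s assume s: "Sup S < s" "s < t"
    then have "s \<in> {a..t}" using Sup by (auto simp: S_def)
    then show "\<exists>y. (v has_real_derivative y) (at s) \<and> y \<le> 0"
      using v neg gt[of s] s by (meson less_imp_le)
  qed
  then show False using Sup c by (auto simp: S_def)
qed

lemma periodic_int_multiple:
  fixes f :: "real \<Rightarrow> 'a"
  assumes f: "\<And>t. f (t + T) = f t"
  shows "f (t + of_int k * T) = f t"
proof -
  have nat: "f (t + real n * T) = f t" for n t
  proof (induction n)
    case (Suc n)
    then show ?case using f[of "t + real n * T"] by (simp add: algebra_simps)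
  qed simp
  show ?thesis
  proof (cases "k \<ge> 0")
    case True
    then show ?thesis using nat[of t "nat k"] by simp
  next
    case False
    then show ?thesis using nat[of "t + of_int k * T" "nat (- k)"] by simp
  qed
qed

section \<open>A contracting periodic equation on an annulus\<close>

text \<open>Freezing the radius at the ends of the annulus makes the field bounded and Lipschitz
  everywhere, as \<open>picard_global\<close> requires, without changing it on the annulus.\<close>

definition clamp_radius :: "real \<Rightarrow> real" where
  "clamp_radius r = max (3/2) (min 3 r)"

lemma clamp_radius_id: "r \<in> {3/2..3} \<Longrightarrow> clamp_radius r = r"
  and clamp_radius_mem: "clamp_radius r \<in> {3/2..3}"
  by (auto simp: clamp_radius_def)

text \<open>
  The annulus \<open>3/2 \<le> r \<le> 3\<close> surrounds the radius \<open>2\<close> of the limit cycle of the averaged equation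
  \<open>dV/dp = m\<^sup>2 (r\<^sup>2 / 2 - r\<^sup>4 / 8)\<close> and stays inside \<open>r\<^sup>2 > 2\<close>, where its right-hand side decreases.
\<close>

locale annular_ode =
  fixes F V K :: "real \<Rightarrow> real \<Rightarrow> real" and \<kappa> :: real
  assumes F_bl: "bounded_lipschitz (\<lambda>z. F (fst z) (clamp_radius (snd z)))"
    and F_periodic: "F (p + 2 * pi) r = F p r"
    and V_periodic: "V (p + 2 * pi) r = V p r"
    and V_deriv: "(\<rho> has_real_derivative F p (\<rho> p)) (at p) \<Longrightarrow> \<rho> p \<in> {3/2..3} \<Longrightarrow>
        ((\<lambda>q. V q (\<rho> q)) has_real_derivative K p (\<rho> p)) (at p)"
    and V_near: "r \<in> {3/2..3} \<Longrightarrow> V p r \<in> {r\<^sup>2 / 2 - 1/10..r\<^sup>2 / 2 + 1/10}"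
    and V_lower: "r \<in> {3/2..3} \<Longrightarrow> r' \<in> {3/2..3} \<Longrightarrow> r \<le> r' \<Longrightarrow> r' - r \<le> V p r' - V p r"
    and V_upper: "r \<in> {3/2..3} \<Longrightarrow> r' \<in> {3/2..3} \<Longrightarrow> r \<le> r' \<Longrightarrow> V p r' - V p r \<le> 4 * (r' - r)"
    and \<kappa>: "\<kappa> > 0"
    and K_dec: "r \<in> {3/2..3} \<Longrightarrow> r' \<in> {3/2..3} \<Longrightarrow> r \<le> r' \<Longrightarrow> K p r' - K p r \<le> - \<kappa> * (r' - r)"
    and K_neg: "r \<in> {3/2..3} \<Longrightarrow> V p r \<ge> 3 \<Longrightarrow> K p r \<le> 0"
    and K_pos: "r \<in> {3/2..3} \<Longrightarrow> V p r \<le> 3/2 \<Longrightarrow> K p r \<ge> 0"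
begin

text \<open>Solutions of the truncated equation; they live on the whole line of angles and solve the
  true equation wherever the radius lies in the annulus.\<close>

definition sol :: "(real \<Rightarrow> real) \<Rightarrow> bool" where
  "sol \<rho> \<longleftrightarrow> (\<forall>p. (\<rho> has_real_derivative F p (clamp_radius (\<rho> p))) (at p))"

lemma F_lipschitz:
  "\<exists>C. \<forall>p r r'. \<bar>F p (clamp_radius r)\<bar> \<le> C \<and>
     \<bar>F p (clamp_radius r) - F p (clamp_radius r')\<bar> \<le> C * \<bar>r - r'\<bar>"
proof (rule bounded_lipschitzE[OF F_bl])
  fix C
  assume C: "C \<ge> 0" "\<And>z. \<bar>F (fst z) (clamp_radius (snd z))\<bar> \<le> C"
    "\<And>z z'. \<bar>F (fst z) (clamp_radius (snd z)) - F (fst z') (clamp_radius (snd z'))\<bar> \<le> C * dist z z'"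
  show ?thesis
  proof (intro exI[of _ C] allI conjI)
    fix p r r'
    show "\<bar>F p (clamp_radius r)\<bar> \<le> C" using C(2)[of "(p, r)"] by simp
    show "\<bar>F p (clamp_radius r) - F p (clamp_radius r')\<bar> \<le> C * \<bar>r - r'\<bar>"
      using C(3)[of "(p, r)" "(p, r')"] by (simp add: dist_prod_def dist_real_def)
  qed
qed

lemma sol_lipschitz:
  assumes "sol \<rho>"
  shows "\<exists>C. \<forall>x y. \<bar>\<rho> x - \<rho> y\<bar> \<le> C * dist x y"
proof -
  obtain C where C: "\<And>p r. \<bar>F p (clamp_radius r)\<bar> \<le> C" using F_lipschitz by blast
  have "norm (\<rho> x - \<rho> y) \<le> C * norm (x - y)" for x y
    by (rule field_differentiable_bound[of UNIV \<rho> "\<lambda>p. F p (clamp_radius (\<rho> p))"])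
      (use assms C in \<open>auto simp: sol_def\<close>)
  then show ?thesis by (auto simp: dist_real_def)
qed

lemma sol_exists: "\<exists>\<rho>. sol \<rho> \<and> \<rho> p0 = r0"
proof -
  obtain C where C: "\<And>p r. \<bar>F p (clamp_radius r)\<bar> \<le> C"
    "\<And>p r r'. \<bar>F p (clamp_radius r) - F p (clamp_radius r')\<bar> \<le> C * \<bar>r - r'\<bar>"
    using F_lipschitz by blast
  have "continuous_on UNIV ((\<lambda>z. F (fst z) (clamp_radius (snd z))) \<circ> (\<lambda>z. (fst z + p0, snd z)))"
    by (intro continuous_on_compose bounded_lipschitz_continuous[OF F_bl] continuous_intros)
  then have "continuous_on UNIV (\<lambda>(t, x). F (t + p0) (clamp_radius x))"
    by (simp add: o_def case_prod_unfold)
  then have "\<exists>u. u 0 = r0 \<and> (\<forall>t. (u has_vector_derivative F (t + p0) (clamp_radius (u t))) (at t))"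
    by (rule picard_global[where L = C and B = C]) (use C in auto)
  then obtain u where u: "u 0 = r0" "\<And>t. (u has_real_derivative F (t + p0) (clamp_radius (u t))) (at t)"
    by (auto simp: has_real_derivative_iff_has_vector_derivative)
  have "((\<lambda>p. u (p - p0)) has_real_derivative F p (clamp_radius (u (p - p0)))) (at p)" for p
    using u(2)[of "p - p0"] DERIV_shift[of u _ p "- p0"] by simp
  then show ?thesis using u(1) by (intro exI[of _ "\<lambda>p. u (p - p0)"]) (simp add: sol_def)
qed

lemma sol_unique:
  assumes "sol \<rho>" "sol \<rho>'" "\<rho> p0 = \<rho>' p0"
  shows "\<rho> p = \<rho>' p"
proof -
  obtain C where C: "\<And>p r r'. \<bar>F p (clamp_radius r) - F p (clamp_radius r')\<bar> \<le> C * \<bar>r - r'\<bar>"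
    using F_lipschitz by blast
  show ?thesis
    by (rule ode_unique_line[where L = C and a = p0])
      (use assms C in \<open>auto simp: sol_def has_real_derivative_iff_has_vector_derivative\<close>)
qed

lemma sol_shift:
  assumes "sol \<rho>"
  shows "sol (\<lambda>p. \<rho> (p + 2 * pi))"
  unfolding sol_def
proof
  fix p
  have "(\<rho> has_real_derivative F (p + 2 * pi) (clamp_radius (\<rho> (p + 2 * pi)))) (at (p + 2 * pi))"
    using assms by (simp add: sol_def)
  then show "((\<lambda>p. \<rho> (p + 2 * pi)) has_real_derivative F p (clamp_radius (\<rho> (p + 2 * pi)))) (at p)"
    by (subst (asm) DERIV_shift[of \<rho>]) (simp add: F_periodic)
qed

text \<open>The inner edge has energy at most 9/8 + 1/10 < 7/5 and the outer edge at least 9/2 -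
  1/10 > 31/10, so these energy levels keep away from both edges.\<close>

lemma interior_radius:
  assumes r: "r \<in> {3/2..3}" and V: "V p r \<in> {7/5..31/10}"
  shows "r \<in> {3/2<..<3}"
proof -
  have near: "V p r \<le> r\<^sup>2 / 2 + 1/10" "r\<^sup>2 / 2 - 1/10 \<le> V p r"
    using V_near[OF r, of p] by auto
  have "r \<noteq> 3/2" using near V by (intro notI) (simp add: power2_eq_square)
  moreover have "r \<noteq> 3" using near V by (intro notI) simp
  ultimately show ?thesis using r by auto
qed

lemma V_along_sol:
  assumes "sol \<rho>" "\<rho> p \<in> {3/2..3}"
  shows "((\<lambda>q. V q (\<rho> q)) has_real_derivative K p (\<rho> p)) (at p)"
proof (rule V_deriv[of \<rho> p, OF _ assms(2)])
  show "(\<rho> has_real_derivative F p (\<rho> p)) (at p)"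
    using assms unfolding sol_def by (metis clamp_radius_id)
qed

text \<open>Two facts support each other: while the radius is in the annulus the signs of
  \<open>K\<close> confine \<open>V\<close>, and confined \<open>V\<close> puts the radius strictly
  inside the annulus. The levels are left variable because the return map uses the band from 3/2 to
  3, whereas attraction of a neighbourhood uses the wider band from 7/5 to 31/10.\<close>

lemma trapping:
  assumes \<rho>: "sol \<rho>" and r0: "\<rho> p0 \<in> {3/2..3}" and V0: "V p0 (\<rho> p0) \<in> {c1..c2}"
    and c: "c1 \<in> {7/5..3/2}" "c2 \<in> {3..31/10}" and p: "p \<ge> p0"
  shows "\<rho> p \<in> {3/2<..<3} \<and> V p (\<rho> p) \<in> {c1..c2}"
proof -
  have Vp: "V p (\<rho> p) \<in> {c1..c2}"
    if "p \<ge> p0" and "\<And>s. s \<in> {p0..p} \<Longrightarrow> \<rho> s \<in> {3/2..3}" for p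
  proof -
    have "V p (\<rho> p) \<le> c2"
    proof (rule upper_barrier[of p0 p "\<lambda>q. V q (\<rho> q)" "\<lambda>q. K q (\<rho> q)"])
      show "((\<lambda>q. V q (\<rho> q)) has_real_derivative K s (\<rho> s)) (at s)" if "s \<in> {p0..p}" for s
        using V_along_sol[OF \<rho> \<open>s \<in> {p0..p} \<Longrightarrow> \<rho> s \<in> {3/2..3}\<close>[OF that]] .
      show "K s (\<rho> s) \<le> 0" if "s \<in> {p0..p}" "c2 \<le> V s (\<rho> s)" for s
        using K_neg[OF \<open>s \<in> {p0..p} \<Longrightarrow> \<rho> s \<in> {3/2..3}\<close>[OF that(1)], of s] that c by simp
    qed (use that V0 in auto)
    moreover have "- V p (\<rho> p) \<le> - c1"
    proof (rule upper_barrier[of p0 p "\<lambda>q. - V q (\<rho> q)" "\<lambda>q. - K q (\<rho> q)"])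
      show "((\<lambda>q. - V q (\<rho> q)) has_real_derivative - K s (\<rho> s)) (at s)" if "s \<in> {p0..p}" for s
        using V_along_sol[OF \<rho> \<open>s \<in> {p0..p} \<Longrightarrow> \<rho> s \<in> {3/2..3}\<close>[OF that]] by (rule DERIV_minus)
      show "- K s (\<rho> s) \<le> 0" if "s \<in> {p0..p}" "- c1 \<le> - V s (\<rho> s)" for s
        using K_pos[OF \<open>s \<in> {p0..p} \<Longrightarrow> \<rho> s \<in> {3/2..3}\<close>[OF that(1)], of s] that c by simp
    qed (use that V0 in auto)
    ultimately show ?thesis by simp
  qed
  have cont: "continuous_on S \<rho>" for S
    using \<rho> unfolding sol_def by (meson DERIV_isCont continuous_at_imp_continuous_on)
  \<comment> \<open>The two-sided condition becomes one inequality about the distance to the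
    midpoint 9/4, which suits the bootstrap.\<close>
  have in_iff: "\<rho> s \<in> {3/2..3} \<longleftrightarrow> \<bar>\<rho> s - 9/4\<bar> \<le> 3/4" "\<rho> s \<in> {3/2<..<3} \<longleftrightarrow> \<bar>\<rho> s - 9/4\<bar> < 3/4" for s
    by (auto simp: abs_if)
  have lt: "\<bar>\<rho> p - 9/4\<bar> < 3/4" if "p \<ge> p0" for p
  proof (rule continuity_bootstrap[where n = "\<lambda>p. \<bar>\<rho> p - 9/4\<bar>" and a = p0])
    show "continuous_on {p0..} (\<lambda>p. \<bar>\<rho> p - 9/4\<bar>)" by (intro continuous_intros cont)
    show "\<bar>\<rho> p0 - 9/4\<bar> < 3/4"
      using interior_radius[OF r0, of p0] V0 c in_iff(2)[of p0] by simp
    fix t assume t: "t \<ge> p0" "\<And>s. s \<in> {p0..t} \<Longrightarrow> \<bar>\<rho> s - 9/4\<bar> \<le> 3/4"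
    then have "\<rho> s \<in> {3/2..3}" if "s \<in> {p0..t}" for s using in_iff(1) that by blast
    from interior_radius[OF this[of t], of t] Vp[OF t(1) this] t(1) c
    have "\<rho> t \<in> {3/2<..<3}" by simp
    then show "\<bar>\<rho> t - 9/4\<bar> < 3/4" using in_iff(2) by blast
  qed (use that in auto)
  have "V p (\<rho> p) \<in> {c1..c2}"
  proof (rule Vp[OF p])
    fix s assume "s \<in> {p0..p}"
    then have "\<bar>\<rho> s - 9/4\<bar> < 3/4" using lt by simp
    then show "\<rho> s \<in> {3/2..3}" using in_iff(1)[of s] by simp
  qed
  then show ?thesis using lt[OF p] in_iff(2) by blast
qed

text \<open>\<open>K\<close> falls in r at rate at least \<open>\<kappa>\<close> while
  \<open>V\<close> rises at rate at most 4, so as a function of \<open>V\<close> the rate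
  \<open>K\<close> falls with slope at least \<open>\<kappa> / 4\<close>. The product form is
  symmetric and needs no order between the two radii.\<close>

lemma V_K_opposite:
  assumes "r \<in> {3/2..3}" "r' \<in> {3/2..3}"
  shows "(V p r - V p r') * (K p r - K p r') \<le> - (\<kappa> / 4) * (V p r - V p r')\<^sup>2"
proof -
  have *: "(V p r' - V p r) * (K p r' - K p r) \<le> - (\<kappa> / 4) * (V p r' - V p r)\<^sup>2"
    if r: "r \<in> {3/2..3}" "r' \<in> {3/2..3}" "r \<le> r'" for r r'
  proof -
    have "V p r' - V p r \<ge> 0" using V_lower[OF r, of p] r by simp
    moreover have "K p r' - K p r \<le> - (\<kappa> / 4) * (V p r' - V p r)"
    proof -
      have "\<kappa> / 4 * (V p r' - V p r) \<le> \<kappa> / 4 * (4 * (r' - r))"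
        using \<kappa> by (intro mult_left_mono V_upper r) auto
      then show ?thesis using K_dec[OF r, of p] by (simp add: algebra_simps)
    qed
    ultimately have "(V p r' - V p r) * (K p r' - K p r)
        \<le> (V p r' - V p r) * (- (\<kappa> / 4) * (V p r' - V p r))"
      by (rule mult_left_mono[rotated])
    then show ?thesis by (simp add: power2_eq_square mult.left_commute)
  qed
  show ?thesis
  proof (cases "r \<le> r'")
    case True
    from *[OF assms True] show ?thesis
      by (metis minus_diff_eq minus_mult_minus power2_commute)
  next
    case False
    then show ?thesis using *[OF assms(2,1)] by simp
  qed
qed

text \<open>For the energy difference D, \<open>V_K_opposite\<close> gives D D' <= -(kappa/4) D^2,
  so exp(kappa p / 2) D^2 does not increase. Both solutions are read at the same angle.\<close>

lemma contraction:
  assumes sol: "sol \<rho>" "sol \<rho>'"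
    and r: "\<And>s. s \<ge> p0 \<Longrightarrow> \<rho> s \<in> {3/2..3}" "\<And>s. s \<ge> p0 \<Longrightarrow> \<rho>' s \<in> {3/2..3}" and p: "p \<ge> p0"
  shows "\<bar>V p (\<rho> p) - V p (\<rho>' p)\<bar> \<le> exp (- (\<kappa> / 4) * (p - p0)) * \<bar>V p0 (\<rho> p0) - V p0 (\<rho>' p0)\<bar>"
proof -
  define D where "D q = V q (\<rho> q) - V q (\<rho>' q)" for q
  define D' where "D' q = K q (\<rho> q) - K q (\<rho>' q)" for q
  have D: "(D has_real_derivative D' q) (at q)" if "q \<ge> p0" for q
    unfolding D_def D'_def using that by (intro DERIV_diff V_along_sol sol r)
  define E where "E q = exp (\<kappa> / 2 * q) * (D q)\<^sup>2" for q
  have "E p \<le> E p0"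
  proof (rule DERIV_nonpos_imp_nonincreasing[OF p])
    fix q assume "p0 \<le> q" "q \<le> p"
    have "(E has_real_derivative exp (\<kappa> / 2 * q) * (\<kappa> / 2 * (D q)\<^sup>2 + 2 * (D q * D' q))) (at q)"
      unfolding E_def using D[OF \<open>p0 \<le> q\<close>]
      by (auto intro!: derivative_eq_intros simp: algebra_simps)
    moreover have "D q * D' q \<le> - (\<kappa> / 4) * (D q)\<^sup>2"
      unfolding D_def D'_def using \<open>p0 \<le> q\<close> by (intro V_K_opposite r)
    then have "\<kappa> / 2 * (D q)\<^sup>2 + 2 * (D q * D' q) \<le> 0" by simp
    then have "exp (\<kappa> / 2 * q) * (\<kappa> / 2 * (D q)\<^sup>2 + 2 * (D q * D' q)) \<le> 0"
      by (simp add: mult_le_0_iff)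
    ultimately show "\<exists>y. (E has_real_derivative y) (at q) \<and> y \<le> 0" by blast
  qed
  then have "exp (- (\<kappa> / 2 * p)) * (exp (\<kappa> / 2 * p) * (D p)\<^sup>2)
      \<le> exp (- (\<kappa> / 2 * p)) * (exp (\<kappa> / 2 * p0) * (D p0)\<^sup>2)"
    unfolding E_def by (rule mult_left_mono) simp
  then have "(D p)\<^sup>2 \<le> exp (- (\<kappa> / 2 * p) + \<kappa> / 2 * p0) * (D p0)\<^sup>2"
    by (simp only: mult.assoc[symmetric] exp_add[symmetric]) simp
  also have "\<dots> = (exp (- (\<kappa> / 4) * (p - p0)) * \<bar>D p0\<bar>)\<^sup>2"
  proof -
    have "(exp (- (\<kappa> / 4) * (p - p0)))\<^sup>2 = exp (- (\<kappa> / 2 * p) + \<kappa> / 2 * p0)"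
      unfolding power2_eq_square exp_add[symmetric] by (simp add: algebra_simps)
    then show ?thesis by (simp add: power_mult_distrib)
  qed
  finally have "\<bar>D p\<bar>\<^sup>2 \<le> (exp (- (\<kappa> / 4) * (p - p0)) * \<bar>D p0\<bar>)\<^sup>2" by simp
  then have "\<bar>D p\<bar> \<le> exp (- (\<kappa> / 4) * (p - p0)) * \<bar>D p0\<bar>" by (rule power2_le_imp_le) simp
  then show ?thesis by (simp add: D_def)
qed

lemma V_continuous: "continuous_on {3/2..3} (V p)"
proof -
  have "4-lipschitz_on {3/2..3} (V p)"
  proof (rule lipschitz_onI)
    fix r r' :: real assume r: "r \<in> {3/2..3}" "r' \<in> {3/2..3}"
    show "dist (V p r) (V p r') \<le> 4 * dist r r'"
      using V_lower[OF r, of p] V_upper[OF r, of p] V_lower[OF r(2,1), of p] V_upper[OF r(2,1), of p]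
      unfolding dist_real_def by (cases "r \<le> r'") auto
  qed simp
  then show ?thesis by (rule lipschitz_on_continuous_on)
qed

text \<open>The return map will act on energy levels, so each level must be attained at the starting
  angle.\<close>

lemma V_surj:
  assumes "v \<in> {3/2..3}"
  shows "\<exists>r\<in>{3/2..3}. V p r = v"
proof -
  have "V p (3/2) \<le> v" "v \<le> V p 3"
    using V_near[of "3/2" p] V_near[of 3 p] assms by (auto simp: power2_eq_square)
  from IVT'[OF this _ V_continuous] show ?thesis by auto
qed

lemma V_abs_lower:
  assumes r: "r \<in> {3/2..3}" "r' \<in> {3/2..3}"
  shows "\<bar>r - r'\<bar> \<le> \<bar>V p r - V p r'\<bar>"
  using V_lower[OF r, of p] V_lower[OF r(2,1), of p] by (cases "r \<le> r'") auto

lemma periodic_sol_exists: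
  "\<exists>\<rho>. sol \<rho> \<and> (\<forall>p. \<rho> (p + 2 * pi) = \<rho> p) \<and> (\<forall>p. \<rho> p \<in> {3/2<..<3} \<and> V p (\<rho> p) \<in> {3/2..3})"
proof -
  \<comment> \<open>\<open>S v\<close> is a chosen solution that starts at angle 0 on the level
    \<open>v\<close>; the return map \<open>P\<close> reads its level after one turn.\<close>
  have "\<forall>v\<in>{3/2..3}. \<exists>\<rho>. sol \<rho> \<and> \<rho> 0 \<in> {3/2..3} \<and> V 0 (\<rho> 0) = v"
    using V_surj[of _ 0] sol_exists[of 0] by metis
  then obtain S where S: "\<And>v. v \<in> {3/2..3} \<Longrightarrow> sol (S v) \<and> S v 0 \<in> {3/2..3} \<and> V 0 (S v 0) = v"
    by metis
  have tr: "S v p \<in> {3/2<..<3} \<and> V p (S v p) \<in> {3/2..3}" if "v \<in> {3/2..3}" "p \<ge> 0" for v p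
    by (rule trapping[of _ 0]) (use S that in auto)
  then have tr': "S v p \<in> {3/2..3}" if "v \<in> {3/2..3}" "p \<ge> 0" for v p
    using tr[OF that] by simp
  define P where "P v = V (2 * pi) (S v (2 * pi))" for v
  have "\<exists>!v. v \<in> {3/2..3} \<and> P v = v"
  proof (rule Banach_fix[where c = "exp (- (\<kappa> / 4) * (2 * pi - 0))"])
    show "exp (- (\<kappa> / 4) * (2 * pi - 0)) < 1" using \<kappa> by simp
    show "P ` {3/2..3} \<subseteq> {3/2..3}" using tr[of _ "2 * pi"] by (auto simp: P_def)
    show "dist (P v) (P w) \<le> exp (- (\<kappa> / 4) * (2 * pi - 0)) * dist v w" if "v \<in> {3/2..3} " "w \<in> {3/2..3}" for v w
      using contraction[of "S v" "S w" 0 "2 * pi"] S[OF that(1)] S[OF that(2)] tr'[OF that(1)] tr'[OF that(2)]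
      by (simp add: P_def dist_real_def)
  qed (auto simp: complete_eq_closed)
  then obtain v where v: "v \<in> {3/2..3}" "P v = v" by blast
  define \<rho> where "\<rho> = S v"
  have \<rho>: "sol \<rho>" using S[OF v(1)] by (simp add: \<rho>_def)
  \<comment> \<open>A fixed level gives a fixed radius because \<open>V 0\<close> is injective on
    the annulus; uniqueness then extends the equality at one angle to all angles.\<close>
  have "V 0 (\<rho> (2 * pi)) = V 0 (\<rho> 0)"
    using V_periodic[of 0] S[OF v(1)] v(2) by (simp add: P_def \<rho>_def)
  then have "\<rho> (0 + 2 * pi) = \<rho> 0"
    using V_abs_lower[of "\<rho> (2 * pi)" "\<rho> 0" 0] tr'[OF v(1), of 0] tr'[OF v(1), of "2 * pi"] by (simp add: \<rho>_def)
  then have per: "\<rho> (p + 2 * pi) = \<rho> p" for p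
    using sol_unique[OF sol_shift[OF \<rho>] \<rho>, of 0 p] by simp
  have "\<rho> p \<in> {3/2<..<3} \<and> V p (\<rho> p) \<in> {3/2..3}" for p
  proof -
    \<comment> \<open>Trapping works only forward from angle 0; periodicity moves an arbitrary angle
      forward by whole turns.\<close>
    obtain n where "- p < real n * (2 * pi)" using reals_Archimedean3[of "2 * pi"] by auto
    then have n: "0 \<le> p + real n * (2 * pi)" by simp
    have "V (p + real n * (2 * pi)) r = V p r" for r
      using periodic_int_multiple[of "\<lambda>p. V p r" "2 * pi" p "int n"] V_periodic by simp
    then show ?thesis
      using tr[OF v(1) n] periodic_int_multiple[of \<rho> "2 * pi" p "int n", OF per] by (simp add: \<rho>_def)
  qed
  then show ?thesis using \<rho> per by blast
qed

text \<open>The energy contraction is converted back into radii by \<open>V_abs_lower\<close>. The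
  second solution only has to start in the wider energy band, so that a whole neighbourhood of the
  periodic one is covered.\<close>

lemma attraction:
  assumes \<rho>: "sol \<rho>" "\<And>p. \<rho> p \<in> {3/2..3}"
    and \<rho>': "sol \<rho>'" "\<rho>' p0 \<in> {3/2..3}" "V p0 (\<rho>' p0) \<in> {7/5..31/10}" and p: "p \<ge> p0"
  shows "\<rho>' p \<in> {3/2<..<3}"
    and "\<bar>\<rho>' p - \<rho> p\<bar> \<le> exp (- (\<kappa> / 4) * (p - p0)) * \<bar>V p0 (\<rho>' p0) - V p0 (\<rho> p0)\<bar>"
proof -
  have tr: "\<rho>' s \<in> {3/2<..<3}" if "s \<ge> p0" for s
    using trapping[OF \<rho>' _ _ that] by simp
  show "\<rho>' p \<in> {3/2<..<3}" using tr[OF p] .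
  have tr': "\<rho>' s \<in> {3/2..3}" if "s \<ge> p0" for s using tr[OF that] by auto
  show "\<bar>\<rho>' p - \<rho> p\<bar> \<le> exp (- (\<kappa> / 4) * (p - p0)) * \<bar>V p0 (\<rho>' p0) - V p0 (\<rho> p0)\<bar>"
    using V_abs_lower[OF tr'[OF p] \<rho>(2)] contraction[OF \<rho>'(1) \<rho>(1) tr' \<rho>(2) p]
    by (meson order_trans)
qed

end

section \<open>Averaging in polar coordinates\<close>

text \<open>
  With \<open>\<theta> = m\<^sup>2\<close>, \<open>x = m X\<close>, \<open>y = m Y\<close> the system becomes \<open>X' = Y\<close>, \<open>Y' = - X + m * hopf_pert a b m X Y\<close>;
  the polar angle is oriented clockwise, \<open>X = r cos p\<close>, \<open>Y = - r sin p\<close>, so that \<open>p' = polar_speed\<close> is close to \<open>1\<close>.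
\<close>

definition hopf_pert :: "real \<Rightarrow> real \<Rightarrow> real \<Rightarrow> real \<Rightarrow> real \<Rightarrow> real" where
  "hopf_pert a b m X Y = - a * X\<^sup>2 - b * m * X ^ 3 + m * (1 - X\<^sup>2) * Y"

text \<open>This is \<open>hopf_pert\<close> at the polar point with one factor r divided out by
  hand, so that the polar equations contain no 1/r.\<close>

definition polar_pert :: "real \<Rightarrow> real \<Rightarrow> real \<Rightarrow> real \<Rightarrow> real \<Rightarrow> real" where
  "polar_pert a b m p r =
     - a * r * (cos p)\<^sup>2 - b * m * r\<^sup>2 * cos p ^ 3 - m * (1 - r\<^sup>2 * (cos p)\<^sup>2) * sin p"

definition polar_speed :: "real \<Rightarrow> real \<Rightarrow> real \<Rightarrow> real \<Rightarrow> real \<Rightarrow> real" where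
  "polar_speed a b m p r = 1 - m * (cos p * polar_pert a b m p r)"

definition polar_slope :: "real \<Rightarrow> real \<Rightarrow> real \<Rightarrow> real \<Rightarrow> real \<Rightarrow> real" where
  "polar_slope a b m p r = - m * r * sin p * polar_pert a b m p r / polar_speed a b m p r"

text \<open>
  The corrector solves the homological equation: its derivative along the rotation \<open>X' = Y\<close>, \<open>Y' = - X\<close>
  is the difference between \<open>r\<^sup>2 / 2 - r\<^sup>4 / 8\<close>, the mean of the energy production \<open>(1 - X\<^sup>2) Y\<^sup>2\<close> over the
  circle of radius \<open>r\<close>, and that production itself.
\<close>

definition corrector :: "real \<Rightarrow> real \<Rightarrow> real" where
  "corrector X Y = - X * Y / 2 + X * Y * (X\<^sup>2 - Y\<^sup>2) / 8"

text \<open>The partial derivative of \<open>corrector\<close> in Y. The one in X does not appear in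
  the error, since the perturbation acts on Y' alone.\<close>

definition corrector_dy :: "real \<Rightarrow> real \<Rightarrow> real" where
  "corrector_dy X Y = - X / 2 + (X ^ 3 - 3 * X * Y\<^sup>2) / 8"

text \<open>The cubic and quartic terms are the rescaled potential of the nonlinear restoring force.
  The inner factor m places the corrector at order m^2 in the energy, the order of the production it
  has to compensate.\<close>

definition energy_tail :: "real \<Rightarrow> real \<Rightarrow> real \<Rightarrow> real \<Rightarrow> real \<Rightarrow> real" where
  "energy_tail a b m X Y = a * X ^ 3 / 3 + b * m * X ^ 4 / 4 + m * corrector X Y"

definition averaged_energy :: "real \<Rightarrow> real \<Rightarrow> real \<Rightarrow> real \<Rightarrow> real \<Rightarrow> real" where
  "averaged_energy a b m X Y = (X\<^sup>2 + Y\<^sup>2) / 2 + m * energy_tail a b m X Y"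

definition polar_energy :: "real \<Rightarrow> real \<Rightarrow> real \<Rightarrow> real \<Rightarrow> real \<Rightarrow> real" where
  "polar_energy a b m p r = averaged_energy a b m (r * cos p) (- r * sin p)"

definition energy_rate_tail :: "real \<Rightarrow> real \<Rightarrow> real \<Rightarrow> real \<Rightarrow> real \<Rightarrow> real" where
  "energy_rate_tail a b m p r = r * polar_pert a b m p r * corrector_dy (r * cos p) (- r * sin p)"

definition polar_energy_rate :: "real \<Rightarrow> real \<Rightarrow> real \<Rightarrow> real \<Rightarrow> real \<Rightarrow> real" where
  "polar_energy_rate a b m p r =
     m\<^sup>2 * (r\<^sup>2 / 2 - r ^ 4 / 8 + m * energy_rate_tail a b m p r) / polar_speed a b m p r"

lemma hopf_pert_polar: "hopf_pert a b m (r * cos p) (- r * sin p) = r * polar_pert a b m p r"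
  by (simp add: hopf_pert_def polar_pert_def power2_eq_square power3_eq_cube algebra_simps)

text \<open>The potential terms cancel the conservative forces exactly. Production plus the
  derivative of the corrector along the rotation is the mean, and what remains is the perturbation
  times \<open>corrector_dy\<close>. The parameter has speed \<open>\<omega>\<close> relative to
  time, so the identity can be used with the angle as parameter.\<close>

lemma averaged_energy_derivative:
  assumes X: "(X has_real_derivative X') (at t)" and Y: "(Y has_real_derivative Y') (at t)"
    and \<omega>: "\<omega> \<noteq> 0" and X': "\<omega> * X' = Y t" and Y': "\<omega> * Y' = - X t + m * hopf_pert a b m (X t) (Y t)"
  shows "((\<lambda>s. averaged_energy a b m (X s) (Y s)) has_real_derivative
    m\<^sup>2 * (((X t)\<^sup>2 + (Y t)\<^sup>2) / 2 - ((X t)\<^sup>2 + (Y t)\<^sup>2)\<^sup>2 / 8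
      + m * hopf_pert a b m (X t) (Y t) * corrector_dy (X t) (Y t)) / \<omega>) (at t)"
proof -
  define x y where "x = X t" and "y = Y t"
  have X'': "X' = y / \<omega>" and Y'': "Y' = (- x + m * hopf_pert a b m x y) / \<omega>"
    using \<omega> X' Y' by (simp_all add: field_simps x_def y_def)
  show ?thesis
    unfolding averaged_energy_def energy_tail_def corrector_def
    apply (rule derivative_eq_intros refl X Y | simp)+
    unfolding x_def[symmetric] y_def[symmetric] X'' Y''
    using \<omega> apply (simp add: field_simps)
    unfolding hopf_pert_def corrector_dy_def
    apply (simp add: field_simps power2_eq_square power3_eq_cube power4_eq_xxxx)
    done
qed

text \<open>Multiplying by the angular speed turns derivatives in the angle back into derivatives in
  time. This serves both the energy computation and the reconstruction of planar solutions.\<close>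

lemma polar_slope_cartesian:
  assumes \<omega>: "polar_speed a b m p r \<noteq> 0"
  shows "polar_speed a b m p r * (polar_slope a b m p r * cos p - r * sin p) = - r * sin p" (is ?X)
    and "polar_speed a b m p r * (- (polar_slope a b m p r * sin p) - r * cos p)
      = - (r * cos p) + m * hopf_pert a b m (r * cos p) (- r * sin p)" (is ?Y)
proof -
  define \<omega> N D where "\<omega> = polar_speed a b m p r" and "N = polar_pert a b m p r" and "D = polar_slope a b m p r"
  have D: "\<omega> * D = - m * r * sin p * N" using assms by (simp add: D_def polar_slope_def \<omega>_def N_def)
  have \<omega>': "\<omega> = 1 - m * (cos p * N)" by (simp add: \<omega>_def polar_speed_def N_def)
  have "\<omega> * (D * cos p - r * sin p) = (\<omega> * D) * cos p - \<omega> * r * sin p" by (simp add: algebra_simps)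
  also have "\<dots> = - r * sin p" by (simp only: D) (simp add: \<omega>' algebra_simps)
  finally show ?X by (simp add: \<omega>_def D_def)
  have "\<omega> * (- (D * sin p) - r * cos p) = - ((\<omega> * D) * sin p) - \<omega> * r * cos p"
    by (simp add: algebra_simps)
  also have "\<dots> = - (r * cos p) + m * (r * N) * ((sin p)\<^sup>2 + (cos p)\<^sup>2)"
    unfolding D unfolding \<omega>' by algebra
  also have "\<dots> = - (r * cos p) + m * hopf_pert a b m (r * cos p) (- r * sin p)"
    by (simp only: hopf_pert_polar N_def sin_cos_squared_add mult_1_right mult.assoc)
  finally show ?Y by (simp add: \<omega>_def D_def)
qed

lemma polar_coordinates_derivative:
  assumes \<rho>: "(\<rho> has_real_derivative D) (at p)"
  shows "((\<lambda>q. \<rho> q * cos q) has_real_derivative (D * cos p - \<rho> p * sin p)) (at p)"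
    and "((\<lambda>q. - \<rho> q * sin q) has_real_derivative (- (D * sin p) - \<rho> p * cos p)) (at p)"
  using \<rho> by (auto intro!: derivative_eq_intros)

lemma polar_energy_derivative:
  assumes \<rho>: "(\<rho> has_real_derivative polar_slope a b m p (\<rho> p)) (at p)"
    and \<omega>: "polar_speed a b m p (\<rho> p) \<noteq> 0"
  shows "((\<lambda>q. polar_energy a b m q (\<rho> q)) has_real_derivative polar_energy_rate a b m p (\<rho> p)) (at p)"
proof -
  have sq: "(\<rho> p * cos p)\<^sup>2 + (- \<rho> p * sin p)\<^sup>2 = (\<rho> p)\<^sup>2"
    by (simp add: power_mult_distrib flip: distrib_left)
  have "((\<rho> p)\<^sup>2)\<^sup>2 = \<rho> p ^ 4" by simp
  then show ?thesis
    using averaged_energy_derivative[OF polar_coordinates_derivative[OF \<rho>] \<omega> polar_slope_cartesian[OF \<omega>]] sq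
    by (simp only: polar_energy_def polar_energy_rate_def energy_rate_tail_def hopf_pert_polar mult.assoc)
qed

lemma polar_energy_expand: "polar_energy a b m p r = r\<^sup>2 / 2 + m * energy_tail a b m (r * cos p) (- r * sin p)"
proof -
  have "(r * cos p)\<^sup>2 + (- r * sin p)\<^sup>2 = r\<^sup>2"
    by (simp add: power_mult_distrib flip: distrib_left)
  then show ?thesis by (simp add: polar_energy_def averaged_energy_def)
qed

text \<open>With N for the polar perturbation, 1/speed = 1 + m (cos p) N / speed. All corrections of
  order m to the averaged rate, those from the numerator and those from the speed, are collected
  here.\<close>

definition rate_remainder :: "real \<Rightarrow> real \<Rightarrow> real \<Rightarrow> real \<Rightarrow> real \<Rightarrow> real" where
  "rate_remainder a b m p r =
    (energy_rate_tail a b m p r + (r\<^sup>2 / 2 - r ^ 4 / 8) * (cos p * polar_pert a b m p r)) / polar_speed a b m p r"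

lemma polar_energy_rate_expand:
  assumes "polar_speed a b m p r \<noteq> 0"
  shows "polar_energy_rate a b m p r = m\<^sup>2 * (r\<^sup>2 / 2 - r ^ 4 / 8 + m * rate_remainder a b m p r)"
proof -
  have "r\<^sup>2 / 2 - r ^ 4 / 8 + m * rate_remainder a b m p r =
     ((r\<^sup>2 / 2 - r ^ 4 / 8) * polar_speed a b m p r
       + m * (energy_rate_tail a b m p r + (r\<^sup>2 / 2 - r ^ 4 / 8) * (cos p * polar_pert a b m p r)))
     / polar_speed a b m p r"
  proof -
    have "A + m * (B / s) = (A * s + m * B) / s" if "s \<noteq> 0" for A B s :: real
      using that by (simp add: field_simps)
    from this[OF assms] show ?thesis unfolding rate_remainder_def by blast
  qed
  also have "(r\<^sup>2 / 2 - r ^ 4 / 8) * polar_speed a b m p r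
       + m * (energy_rate_tail a b m p r + (r\<^sup>2 / 2 - r ^ 4 / 8) * (cos p * polar_pert a b m p r))
     = r\<^sup>2 / 2 - r ^ 4 / 8 + m * energy_rate_tail a b m p r"
    unfolding polar_speed_def by (simp add: algebra_simps)
  finally show ?thesis by (simp add: polar_energy_rate_def)
qed

section \<open>Uniform estimates for the polar equation\<close>

lemma lipschitz_fst: "\<bar>fst z - fst z'\<bar> \<le> 1 * dist z z'" for z z' :: "real \<times> 'a::metric_space"
  using dist_fst_le[of z z'] by (simp add: dist_real_def)

lemma lipschitz_snd: "\<bar>snd z - snd z'\<bar> \<le> 1 * dist z z'" for z z' :: "'a::metric_space \<times> real"
  using dist_snd_le[of z z'] by (simp add: dist_real_def)

lemma lipschitz_fst_snd: "\<bar>fst (snd z) - fst (snd z')\<bar> \<le> 1 * dist z z'" for z z' :: "'b::metric_space \<times> real \<times> 'a::metric_space"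
  using dist_snd_le[of z z'] dist_fst_le[of "snd z" "snd z'"] by (simp add: dist_real_def)

lemma lipschitz_snd_snd: "\<bar>snd (snd z) - snd (snd z')\<bar> \<le> 1 * dist z z'" for z z' :: "'b::metric_space \<times> 'a::metric_space \<times> real"
  using dist_snd_le[of z z'] dist_snd_le[of "snd z" "snd z'"] by (simp add: dist_real_def)

lemma polar_pert_bl:
  assumes "bounded_lipschitz m" "bounded_lipschitz r" "bounded_lipschitz (\<lambda>z. cos (p z))" "bounded_lipschitz (\<lambda>z. sin (p z))"
  shows "bounded_lipschitz (\<lambda>z. polar_pert a b (m z) (p z) (r z))"
  unfolding polar_pert_def by (intro bl_intros assms)

text \<open>Angle, radius and m are treated as one variable in a product space, the last two
  clamped. A single application of the \<open>bounded_lipschitz\<close> calculus then gives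
  constants that do not depend on p or m, together with the Lipschitz bound in r.\<close>

lemma polar_bounds:
  "\<exists>m1>0. \<exists>C\<ge>0. \<forall>p. \<forall>m\<in>{0..m1}. \<forall>r\<in>{3/2..3}. polar_speed a b m p r \<ge> 1/2 \<and>
     \<bar>energy_tail a b m (r * cos p) (- r * sin p)\<bar> \<le> C \<and> \<bar>rate_remainder a b m p r\<bar> \<le> C \<and>
     (\<forall>r'\<in>{3/2..3}.
       \<bar>energy_tail a b m (r * cos p) (- r * sin p) - energy_tail a b m (r' * cos p) (- r' * sin p)\<bar> \<le> C * \<bar>r - r'\<bar> \<and>
       \<bar>rate_remainder a b m p r - rate_remainder a b m p r'\<bar> \<le> C * \<bar>r - r'\<bar>)"
proof -
  let ?r = "\<lambda>z :: real \<times> real \<times> real. clamp_radius (fst (snd z))"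
  let ?m = "\<lambda>u (z :: real \<times> real \<times> real). max 0 (min u (snd (snd z)))"
  let ?p = "fst :: real \<times> real \<times> real \<Rightarrow> real"
  have bl: "bounded_lipschitz ?r" "\<And>u. bounded_lipschitz (?m u)" "bounded_lipschitz (\<lambda>z. cos (?p z))"
      "bounded_lipschitz (\<lambda>z. sin (?p z))"
    unfolding clamp_radius_def
    by (rule bounded_lipschitz_clamp[OF lipschitz_fst_snd] bounded_lipschitz_clamp[OF lipschitz_snd_snd]
      bounded_lipschitz_cos[OF lipschitz_fst] bounded_lipschitz_sin[OF lipschitz_fst])+
  have pert: "bounded_lipschitz (\<lambda>z. cos (?p z) * polar_pert a b (?m u z) (?p z) (?r z))" for u
    by (intro bl_intros polar_pert_bl bl)
  obtain B where B: "B \<ge> 0" "\<And>z. \<bar>cos (?p z) * polar_pert a b (?m 1 z) (?p z) (?r z)\<bar> \<le> B"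
    using pert[of 1] unfolding bounded_lipschitz_def by blast
  \<comment> \<open>\<open>B\<close> bounds the perturbation for m up to 1; this \<open>m1\<close>
    is at most 1 and makes the speed differ from 1 by at most 1/2.\<close>
  define m1 where "m1 = 1 / (2 * (B + 1))"
  have m1: "m1 > 0" "m1 \<le> 1" "m1 * B \<le> 1/2" using B(1) by (auto simp: m1_def field_simps)
  have speed0: "polar_speed a b m p r \<ge> 1/2" if "m \<in> {0..m1}" "r \<in> {3/2..3}" for p m r
  proof -
    have "\<bar>cos p * polar_pert a b m p r\<bar> \<le> B"
    proof -
      have "max 0 (min 1 m) = m" using that m1(2) by auto
      then show ?thesis using B(2)[of "(p, r, m)"] that by (simp add: clamp_radius_id)
    qed
    then have "m * (cos p * polar_pert a b m p r) \<le> m1 * B"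
    proof -
      have "m * (cos p * polar_pert a b m p r) \<le> m * B"
        using that \<open>\<bar>cos p * polar_pert a b m p r\<bar> \<le> B\<close> by (intro mult_left_mono) auto
      also have "\<dots> \<le> m1 * B" using that B(1) by (intro mult_right_mono) auto
      finally show ?thesis .
    qed
    then show ?thesis using m1(3) by (simp add: polar_speed_def)
  qed
  have speed: "polar_speed a b (?m m1 z) (?p z) (?r z) \<ge> 1/2" for z
    using m1(1) by (intro speed0 clamp_radius_mem) auto
  have bl1: "bounded_lipschitz (\<lambda>z. energy_tail a b (?m m1 z) (?r z * cos (?p z)) (- ?r z * sin (?p z)))"
    unfolding energy_tail_def corrector_def by (intro bl_intros bl)
  have bl2: "bounded_lipschitz (\<lambda>z. rate_remainder a b (?m m1 z) (?p z) (?r z))"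
    unfolding rate_remainder_def
  proof (rule bounded_lipschitz_divide_half[OF _ _ speed])
    show "bounded_lipschitz (\<lambda>z. polar_speed a b (?m m1 z) (?p z) (?r z))"
      unfolding polar_speed_def by (intro bl_intros pert bl)
    show "bounded_lipschitz (\<lambda>z. energy_rate_tail a b (?m m1 z) (?p z) (?r z)
        + ((?r z)\<^sup>2 / 2 - ?r z ^ 4 / 8) * (cos (?p z) * polar_pert a b (?m m1 z) (?p z) (?r z)))"
      unfolding energy_rate_tail_def corrector_dy_def by (intro bl_intros polar_pert_bl pert bl)
  qed
  obtain C1 where C1: "C1 \<ge> 0" 
    "\<And>z. \<bar>energy_tail a b (?m m1 z) (?r z * cos (?p z)) (- ?r z * sin (?p z))\<bar> \<le> C1"
    "\<And>z z'. \<bar>energy_tail a b (?m m1 z) (?r z * cos (?p z)) (- ?r z * sin (?p z))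
      - energy_tail a b (?m m1 z') (?r z' * cos (?p z')) (- ?r z' * sin (?p z'))\<bar> \<le> C1 * dist z z'"
    using bl1 unfolding bounded_lipschitz_def by blast
  obtain C2 where C2: "C2 \<ge> 0" 
    "\<And>z. \<bar>rate_remainder a b (?m m1 z) (?p z) (?r z)\<bar> \<le> C2"
    "\<And>z z'. \<bar>rate_remainder a b (?m m1 z) (?p z) (?r z) - rate_remainder a b (?m m1 z') (?p z') (?r z')\<bar> \<le> C2 * dist z z'"
    using bl2 unfolding bounded_lipschitz_def by blast
  define C where "C = max C1 C2"
  have mm: "max 0 (min m1 m) = m" if "m \<in> {0..m1}" for m using that by auto
  have dist: "dist (p, r, m) (p, r', m) = \<bar>r - r'\<bar>" for p r r' m :: real
    by (simp add: dist_prod_def dist_real_def)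
  have le: "C1 * \<bar>r - r'\<bar> \<le> C * \<bar>r - r'\<bar>" "C2 * \<bar>r - r'\<bar> \<le> C * \<bar>r - r'\<bar>" for r r' :: real
    by (auto simp: C_def intro!: mult_right_mono)
  have "polar_speed a b m p r \<ge> 1/2 \<and>
     \<bar>energy_tail a b m (r * cos p) (- r * sin p)\<bar> \<le> C \<and> \<bar>rate_remainder a b m p r\<bar> \<le> C \<and>
     (\<forall>r'\<in>{3/2..3}.
       \<bar>energy_tail a b m (r * cos p) (- r * sin p) - energy_tail a b m (r' * cos p) (- r' * sin p)\<bar> \<le> C * \<bar>r - r'\<bar> \<and>
       \<bar>rate_remainder a b m p r - rate_remainder a b m p r'\<bar> \<le> C * \<bar>r - r'\<bar>)"
    if "m \<in> {0..m1}" "r \<in> {3/2..3}" for p m r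
  proof (intro conjI ballI)
    show "polar_speed a b m p r \<ge> 1/2" by (rule speed0[OF that])
    show "\<bar>energy_tail a b m (r * cos p) (- r * sin p)\<bar> \<le> C"
      using C1(2)[of "(p, r, m)"] unfolding fst_conv snd_conv mm[OF that(1)] clamp_radius_id[OF that(2)] C_def by linarith
    show "\<bar>rate_remainder a b m p r\<bar> \<le> C"
      using C2(2)[of "(p, r, m)"] unfolding fst_conv snd_conv mm[OF that(1)] clamp_radius_id[OF that(2)] C_def by linarith
    fix r' :: real assume r': "r' \<in> {3/2..3}"
    show "\<bar>energy_tail a b m (r * cos p) (- r * sin p) - energy_tail a b m (r' * cos p) (- r' * sin p)\<bar> \<le> C * \<bar>r - r'\<bar>"
      using C1(3)[of "(p, r, m)" "(p, r', m)"] le(1)[of r r']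
      unfolding dist fst_conv snd_conv mm[OF that(1)] clamp_radius_id[OF that(2)] clamp_radius_id[OF r'] by linarith
    show "\<bar>rate_remainder a b m p r - rate_remainder a b m p r'\<bar> \<le> C * \<bar>r - r'\<bar>"
      using C2(3)[of "(p, r, m)" "(p, r', m)"] le(2)[of r r']
      unfolding dist fst_conv snd_conv mm[OF that(1)] clamp_radius_id[OF that(2)] clamp_radius_id[OF r'] by linarith
  qed
  then show ?thesis using m1(1) C1(1) by (intro exI[of _ m1] exI[of _ C] conjI) (auto simp: C_def)
qed

text \<open>The rate difference is the difference of r^2/2 times 1 - (r^2 + r'^2)/4. Since both
  squares are at least 9/4, the second factor is at most -1/8, and 1/8 times 3/2 gives 3/16.\<close>

lemma averaged_rate_gap:
  fixes r r' :: real
  assumes "r \<in> {3/2..3}" "r' \<in> {3/2..3}" "r \<le> r'"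
  shows "3/2 * (r' - r) \<le> r'\<^sup>2 / 2 - r\<^sup>2 / 2" "r'\<^sup>2 / 2 - r\<^sup>2 / 2 \<le> 3 * (r' - r)"
    "(r'\<^sup>2 / 2 - r' ^ 4 / 8) - (r\<^sup>2 / 2 - r ^ 4 / 8) \<le> - (3/16) * (r' - r)"
proof -
  have eq: "r'\<^sup>2 / 2 - r\<^sup>2 / 2 = ((r + r') / 2) * (r' - r)"
    by (simp add: power2_eq_square field_simps)
  show 1: "3/2 * (r' - r) \<le> r'\<^sup>2 / 2 - r\<^sup>2 / 2" unfolding eq using assms by (intro mult_right_mono) auto
  show "r'\<^sup>2 / 2 - r\<^sup>2 / 2 \<le> 3 * (r' - r)" unfolding eq using assms by (intro mult_right_mono) auto
  have sq: "r\<^sup>2 \<ge> 9/4" "r'\<^sup>2 \<ge> 9/4"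
    using mult_mono[of "3/2" r "3/2" r] mult_mono[of "3/2" r' "3/2" r'] assms by (auto simp: power2_eq_square)
  have "(r'\<^sup>2 / 2 - r' ^ 4 / 8) - (r\<^sup>2 / 2 - r ^ 4 / 8) = (r'\<^sup>2 / 2 - r\<^sup>2 / 2) * (1 - (r\<^sup>2 + r'\<^sup>2) / 4)"
    by (simp add: power2_eq_square power4_eq_xxxx field_simps)
  also have "\<dots> \<le> (r'\<^sup>2 / 2 - r\<^sup>2 / 2) * (- (1/8))"
  proof (rule mult_left_mono)
    show "1 - (r\<^sup>2 + r'\<^sup>2) / 4 \<le> - (1/8)" using sq by (simp add: field_simps)
    show "0 \<le> r'\<^sup>2 / 2 - r\<^sup>2 / 2" using power_mono[of r r' 2] assms by simp
  qed
  also have "\<dots> \<le> - (3/16) * (r' - r)" using 1 by simp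
  finally show "(r'\<^sup>2 / 2 - r' ^ 4 / 8) - (r\<^sup>2 / 2 - r ^ 4 / 8) \<le> - (3/16) * (r' - r)" .
qed

text \<open>All conditions of the locale hold with a fixed margin for the averaged equation; for
  small m the remainders are smaller than these margins.\<close>

lemma annular_ode_polar:
  "\<exists>m0>0. \<forall>m. 0 < m \<and> m < m0 \<longrightarrow>
     annular_ode (polar_slope a b m) (polar_energy a b m) (polar_energy_rate a b m) (m\<^sup>2 / 8) \<and>
     (\<forall>p. \<forall>r\<in>{3/2..3}. polar_speed a b m p r \<ge> 1/2)"
proof -
  obtain m1 C where m1: "m1 > 0" and C: "C \<ge> 0" and
    bnd: "\<And>p m r. m \<in> {0..m1} \<Longrightarrow> r \<in> {3/2..3} \<Longrightarrow> polar_speed a b m p r \<ge> 1/2 \<and>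
     \<bar>energy_tail a b m (r * cos p) (- r * sin p)\<bar> \<le> C \<and> \<bar>rate_remainder a b m p r\<bar> \<le> C" and
    lip: "\<And>p m r r'. m \<in> {0..m1} \<Longrightarrow> r \<in> {3/2..3} \<Longrightarrow> r' \<in> {3/2..3} \<Longrightarrow>
       \<bar>energy_tail a b m (r * cos p) (- r * sin p) - energy_tail a b m (r' * cos p) (- r' * sin p)\<bar> \<le> C * \<bar>r - r'\<bar> \<and>
       \<bar>rate_remainder a b m p r - rate_remainder a b m p r'\<bar> \<le> C * \<bar>r - r'\<bar>"
    using polar_bounds[of a b] by metis
  \<comment> \<open>With this bound every term of order m is at most 1/16, both in size and as a
    Lipschitz constant in r. Thus 1/16 < 1/10 for the energy, 3/2 - 1/16 > 1 and 3 + 1/16 < 4 for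
    its slopes, and 3/16 - 1/16 = 1/8 for the rate, whence \<open>m\<^sup>2 / 8\<close>.\<close>
  define m0 where "m0 = min m1 (1 / (16 * (C + 1)))"
  have m0: "m0 > 0" using m1 C by (simp add: m0_def)
  have "annular_ode (polar_slope a b m) (polar_energy a b m) (polar_energy_rate a b m) (m\<^sup>2 / 8)"
    and "\<And>p r. r \<in> {3/2..3} \<Longrightarrow> polar_speed a b m p r \<ge> 1/2" if m: "0 < m" "m < m0" for m
  proof -
    have m': "m \<in> {0..m1}" using m by (simp add: m0_def)
    have "m \<le> 1 / (16 * (C + 1))" using m by (simp add: m0_def)
    then have "m * (16 * (C + 1)) \<le> 1" using C by (simp add: field_simps)
    then have mC: "m * C \<le> 1/16" using m by (simp add: algebra_simps)
    note bnd = bnd[OF m'] and lip = lip[OF m']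
    show sp: "polar_speed a b m p r \<ge> 1/2" if "r \<in> {3/2..3}" for p r using bnd[OF that] by blast
    then have sp0: "polar_speed a b m p r \<noteq> 0" if "r \<in> {3/2..3}" for p r using that by (smt (verit) divide_pos_pos)
    have small: "\<bar>m * x\<bar> \<le> 1/16" if "\<bar>x\<bar> \<le> C" for x
    proof -
      have "\<bar>m * x\<bar> = m * \<bar>x\<bar>" using m by (simp add: abs_mult)
      also have "\<dots> \<le> m * C" using that m by (intro mult_left_mono) auto
      finally show ?thesis using mC by linarith
    qed
    have smalld: "\<bar>m * x - m * y\<bar> \<le> 1/16 * \<bar>r - r'\<bar>" if "\<bar>x - y\<bar> \<le> C * \<bar>r - r'\<bar>" for x y r r' :: real
    proof -
      have "\<bar>m * x - m * y\<bar> = m * \<bar>x - y\<bar>" using m by (simp add: abs_mult flip: right_diff_distrib)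
      also have "\<dots> \<le> (m * C) * \<bar>r - r'\<bar>" using mult_left_mono[OF that, of m] m by simp
      also have "\<dots> \<le> 1/16 * \<bar>r - r'\<bar>" by (intro mult_right_mono mC) simp
      finally show ?thesis .
    qed
    have tail: "\<bar>m * energy_tail a b m (r * cos p) (- r * sin p)\<bar> \<le> 1/16" "\<bar>m * rate_remainder a b m p r\<bar> \<le> 1/16"
      if "r \<in> {3/2..3}" for p r using bnd[OF that] small by blast+
    have near: "polar_energy a b m p r \<in> {r\<^sup>2 / 2 - 1/10..r\<^sup>2 / 2 + 1/10}" if "r \<in> {3/2..3}" for p r
      using tail(1)[OF that, of p] unfolding polar_energy_expand atLeastAtMost_iff by linarith
    show "annular_ode (polar_slope a b m) (polar_energy a b m) (polar_energy_rate a b m) (m\<^sup>2 / 8)"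
    proof
      show "bounded_lipschitz (\<lambda>z. polar_slope a b m (fst z) (clamp_radius (snd z)))"
      proof -
        have bl: "bounded_lipschitz (\<lambda>z :: real \<times> real. clamp_radius (snd z))" "bounded_lipschitz (\<lambda>z :: real \<times> real. cos (fst z))"
          "bounded_lipschitz (\<lambda>z :: real \<times> real. sin (fst z))"
          unfolding clamp_radius_def
          by (rule bounded_lipschitz_clamp[OF lipschitz_snd]
            bounded_lipschitz_cos[OF lipschitz_fst] bounded_lipschitz_sin[OF lipschitz_fst])+
        show ?thesis unfolding polar_slope_def
        proof (rule bounded_lipschitz_divide_half[OF _ _ sp[OF clamp_radius_mem]])
          show "bounded_lipschitz (\<lambda>z :: real \<times> real. polar_speed a b m (fst z) (clamp_radius (snd z)))"
            unfolding polar_speed_def by (intro bl_intros polar_pert_bl bl)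
          show "bounded_lipschitz (\<lambda>z :: real \<times> real. - m * clamp_radius (snd z) * sin (fst z)
              * polar_pert a b m (fst z) (clamp_radius (snd z)))"
            by (intro bl_intros polar_pert_bl bl)
        qed
      qed
      show "polar_slope a b m (p + 2 * pi) r = polar_slope a b m p r" for p r
        by (simp add: polar_slope_def polar_speed_def polar_pert_def)
      show "polar_energy a b m (p + 2 * pi) r = polar_energy a b m p r" for p r
        by (simp add: polar_energy_def)
      show "((\<lambda>q. polar_energy a b m q (\<rho> q)) has_real_derivative polar_energy_rate a b m p (\<rho> p)) (at p)"
        if "(\<rho> has_real_derivative polar_slope a b m p (\<rho> p)) (at p)" "\<rho> p \<in> {3/2..3}" for \<rho> p
        by (rule polar_energy_derivative[OF that(1) sp0[OF that(2)]])
      show "polar_energy a b m p r \<in> {r\<^sup>2 / 2 - 1/10..r\<^sup>2 / 2 + 1/10}" if "r \<in> {3/2..3}" for p r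
        by (rule near[OF that])
      show "m\<^sup>2 / 8 > 0" using m by simp
    next
      fix r r' p :: real assume r: "r \<in> {3/2..3}" "r' \<in> {3/2..3}" "r \<le> r'"
      have "\<bar>m * energy_tail a b m (r * cos p) (- r * sin p) - m * energy_tail a b m (r' * cos p) (- r' * sin p)\<bar>
        \<le> 1/16 * (r' - r)" using smalld[OF conjunct1[OF lip[OF r(1,2), of p]]] r by simp
      moreover have "r' - r \<le> (A' + x') - (A + x)" "(A' + x') - (A + x) \<le> 4 * (r' - r)"
        if "3/2 * (r' - r) \<le> A' - A" "A' - A \<le> 3 * (r' - r)" "\<bar>x - x'\<bar> \<le> 1/16 * (r' - r)"
        for A A' x x' :: real
        using that r(3) unfolding right_diff_distrib by - linarith+
      ultimately show "r' - r \<le> polar_energy a b m p r' - polar_energy a b m p r"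
        "polar_energy a b m p r' - polar_energy a b m p r \<le> 4 * (r' - r)"
        unfolding polar_energy_expand using averaged_rate_gap(1,2)[OF r] by blast+
      have "\<bar>m * rate_remainder a b m p r - m * rate_remainder a b m p r'\<bar> \<le> 1/16 * (r' - r)"
        using smalld[OF conjunct2[OF lip[OF r(1,2), of p]]] r by simp
      moreover have "(A' + x') - (A + x) \<le> - (1/8) * (r' - r)"
        if "A' - A \<le> - (3/16) * (r' - r)" "\<bar>x - x'\<bar> \<le> 1/16 * (r' - r)" for A A' x x' :: real
        using that r(3) unfolding right_diff_distrib by linarith
      ultimately have "(r'\<^sup>2 / 2 - r' ^ 4 / 8 + m * rate_remainder a b m p r')
          - (r\<^sup>2 / 2 - r ^ 4 / 8 + m * rate_remainder a b m p r) \<le> - (1/8) * (r' - r)"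
        using averaged_rate_gap(3)[OF r] by blast
      from mult_left_mono[OF this, of "m\<^sup>2"]
      show "polar_energy_rate a b m p r' - polar_energy_rate a b m p r \<le> - (m\<^sup>2 / 8) * (r' - r)"
        unfolding polar_energy_rate_expand[OF sp0[OF r(1)]] polar_energy_rate_expand[OF sp0[OF r(2)]]
        by (simp add: algebra_simps)
    next
      fix r p :: real assume r: "r \<in> {3/2..3}"
      have K0: "r\<^sup>2 / 2 - r ^ 4 / 8 = r\<^sup>2 / 2 * (1 - r\<^sup>2 / 4)"
        by (simp add: power2_eq_square power4_eq_xxxx field_simps)
      {
        \<comment> \<open>At level 3 and above, r^2/2 is at least 3 - 1/10, so the averaged rate is
          below -1; at level 3/2 and below it is at least 9/8 * 1/5. Both dominate the remainder
          1/16.\<close>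
        assume "polar_energy a b m p r \<ge> 3"
        then have "r\<^sup>2 / 2 \<ge> 29/10" using near[OF r, of p] by simp
        then have "r\<^sup>2 / 2 * (r\<^sup>2 / 4 - 1) \<ge> 29/10 * (9/20)" by (intro mult_mono) auto
        moreover have "r\<^sup>2 / 2 * (r\<^sup>2 / 4 - 1) = - (r\<^sup>2 / 2 - r ^ 4 / 8)" unfolding K0 by (simp add: algebra_simps)
        ultimately have "r\<^sup>2 / 2 - r ^ 4 / 8 + m * rate_remainder a b m p r \<le> 0"
          using tail(2)[OF r, of p] by linarith
        then show "polar_energy_rate a b m p r \<le> 0"
          unfolding polar_energy_rate_expand[OF sp0[OF r]] by (intro mult_nonneg_nonpos) auto
      }
      {
        assume "polar_energy a b m p r \<le> 3/2"
        then have "r\<^sup>2 / 2 \<le> 8/5" using near[OF r, of p] by simp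
        moreover have "r\<^sup>2 / 2 \<ge> 9/8" using mult_mono[of "3/2" r "3/2" r] r by (simp add: power2_eq_square)
        ultimately have "r\<^sup>2 / 2 * (1 - r\<^sup>2 / 4) \<ge> 9/8 * (1/5)" by (intro mult_mono) auto
        then have "r\<^sup>2 / 2 - r ^ 4 / 8 + m * rate_remainder a b m p r \<ge> 0"
          using tail(2)[OF r, of p] unfolding K0 by linarith
        then show "polar_energy_rate a b m p r \<ge> 0"
          unfolding polar_energy_rate_expand[OF sp0[OF r]] by simp
      }
    qed
  qed
  then show ?thesis using m0 by blast
qed

section \<open>Stability of the equilibrium\<close>

lemma vector2_axis: "vector [x, y] = x *\<^sub>R axis 1 1 + y *\<^sub>R (axis 2 1 :: real^2)"
  by (simp add: vec_eq_iff forall_2 axis_def)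

lemma vector2_eta: "vector [z $ 1, z $ 2] = (z :: real^2)"
  by (simp add: vec_eq_iff forall_2)

lemma has_vector_derivative_real2_iff:
  fixes \<gamma> :: "real \<Rightarrow> real^2"
  shows "(\<gamma> has_vector_derivative v) (at t within S) \<longleftrightarrow>
    ((\<lambda>t. \<gamma> t $ 1) has_real_derivative v $ 1) (at t within S) \<and>
    ((\<lambda>t. \<gamma> t $ 2) has_real_derivative v $ 2) (at t within S)"
    (is "?L \<longleftrightarrow> ?R")
proof
  assume ?L
  then show ?R
    using bounded_linear.has_vector_derivative[OF bounded_linear_vec_nth]
    by (auto simp: has_real_derivative_iff_has_vector_derivative)
next
  assume R: ?R
  have "((\<lambda>t. vector [\<gamma> t $ 1, \<gamma> t $ 2]) has_vector_derivative (vector [v $ 1, v $ 2] :: real^2)) (at t within S)"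
    unfolding vector2_axis using R
    by (auto intro!: derivative_eq_intros simp: has_real_derivative_iff_has_vector_derivative)
  then show ?L by (simp add: vector2_eta)
qed

lemma norm_real2_sq: "(norm (z :: real^2))\<^sup>2 = (z $ 1)\<^sup>2 + (z $ 2)\<^sup>2"
  by (simp add: norm_vec_def L2_set_def sum_2)

lemma norm_real2_le: "norm (z :: real^2) \<le> \<bar>z $ 1\<bar> + \<bar>z $ 2\<bar>"
  using norm_le_l1_cart[of z] by (simp add: sum_2)

text \<open>The restoring force of \<open>vdp_field\<close> multiplied out: its linear coefficient
  is 1, and d and e enter through the two nonlinear coefficients only.\<close>

definition cubic_field :: "real \<Rightarrow> real \<Rightarrow> real \<Rightarrow> real^2 \<Rightarrow> real^2" where
  "cubic_field a b \<theta> z =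
     vector [z $ 2, - ((z $ 1)\<^sup>2 - \<theta>) * z $ 2 - (z $ 1 + a * (z $ 1)\<^sup>2 + b * (z $ 1) ^ 3)]"

lemma vdp_field_eq_cubic:
  assumes "d \<noteq> 0" "e \<noteq> 0"
  shows "vdp_field d e \<theta> = cubic_field (1 / d + 1 / e) (1 / (d * e)) \<theta>"
proof
  fix z :: "real^2"
  have "x * (x + d) * (x + e) / (d * e) = x + (1 / d + 1 / e) * x\<^sup>2 + 1 / (d * e) * x ^ 3" for x :: real
    using assms by (simp add: field_simps power2_eq_square power3_eq_cube)
  then show "vdp_field d e \<theta> z = cubic_field (1 / d + 1 / e) (1 / (d * e)) \<theta> z"
    by (simp add: vdp_field_def cubic_field_def)
qed

text \<open>Clamping each coordinate, rather than projecting to a disc, keeps the truncated field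
  within the \<open>bounded_lipschitz\<close> calculus.\<close>

definition clamp_coords :: "real \<Rightarrow> real^2 \<Rightarrow> real^2" where
  "clamp_coords R z = vector [max (- R) (min R (z $ 1)), max (- R) (min R (z $ 2))]"

lemma clamp_coords_id:
  assumes "norm z \<le> R"
  shows "clamp_coords R z = z"
proof -
  have "max (- R) (min R (z $ i)) = z $ i" for i
    using component_le_norm_cart[of z i] assms by linarith
  then show ?thesis by (simp add: clamp_coords_def vector2_eta)
qed

lemma truncated_cubic_field_bounded_lipschitz:
  obtains C where "\<And>z w. norm (cubic_field a b \<theta> (clamp_coords R z)) \<le> C"
    "\<And>z w. norm (cubic_field a b \<theta> (clamp_coords R z) - cubic_field a b \<theta> (clamp_coords R w)) \<le> C * norm (z - w)"
proof -
  have lip: "\<bar>(z $ i) - (w $ i)\<bar> \<le> 1 * dist z w" for z w :: "real^2" and i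
    using component_le_norm_cart[of "z - w" i] by (simp add: dist_norm)
  have bl: "bounded_lipschitz (\<lambda>z :: real^2. max (- R) (min R (z $ i)))" for i
    by (rule bounded_lipschitz_clamp[OF lip])
  have "bounded_lipschitz (\<lambda>z. cubic_field a b \<theta> (clamp_coords R z) $ 1)"
    unfolding cubic_field_def clamp_coords_def vector_2 by (rule bl)
  then obtain C1 where C1: "\<And>z. \<bar>cubic_field a b \<theta> (clamp_coords R z) $ 1\<bar> \<le> C1"
    "\<And>z w. \<bar>cubic_field a b \<theta> (clamp_coords R z) $ 1 - cubic_field a b \<theta> (clamp_coords R w) $ 1\<bar> \<le> C1 * dist z w"
    unfolding bounded_lipschitz_def by blast
  have "bounded_lipschitz (\<lambda>z. cubic_field a b \<theta> (clamp_coords R z) $ 2)"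
    unfolding cubic_field_def clamp_coords_def vector_2 by (intro bl_intros bl)
  then obtain C2 where C2: "\<And>z. \<bar>cubic_field a b \<theta> (clamp_coords R z) $ 2\<bar> \<le> C2"
    "\<And>z w. \<bar>cubic_field a b \<theta> (clamp_coords R z) $ 2 - cubic_field a b \<theta> (clamp_coords R w) $ 2\<bar> \<le> C2 * dist z w"
    unfolding bounded_lipschitz_def by blast
  show ?thesis
  proof (rule that[of "C1 + C2"])
    show "norm (cubic_field a b \<theta> (clamp_coords R z)) \<le> C1 + C2" for z
      using norm_real2_le[of "cubic_field a b \<theta> (clamp_coords R z)"] C1(1)[of z] C2(1)[of z] by linarith
    show "norm (cubic_field a b \<theta> (clamp_coords R z) - cubic_field a b \<theta> (clamp_coords R w)) \<le> (C1 + C2) * norm (z - w)" for z w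
      using norm_real2_le[of "cubic_field a b \<theta> (clamp_coords R z) - cubic_field a b \<theta> (clamp_coords R w)"]
        C1(2)[of z w] C2(2)[of z w] by (simp add: dist_norm distrib_right)
  qed
qed

lemma cubic_field_lipschitz:
  "\<exists>L. \<forall>z w. norm z \<le> R \<longrightarrow> norm w \<le> R \<longrightarrow>
     norm (cubic_field a b \<theta> z - cubic_field a b \<theta> w) \<le> L * norm (z - w)"
proof (rule truncated_cubic_field_bounded_lipschitz[of a b \<theta> R])
  fix C assume "\<And>z w. norm (cubic_field a b \<theta> (clamp_coords R z) - cubic_field a b \<theta> (clamp_coords R w)) \<le> C * norm (z - w)"
  then show ?thesis by (metis clamp_coords_id)
qed

lemma truncated_solution_exists:
  "\<exists>\<gamma>. \<gamma> 0 = q \<and> (\<forall>t. (\<gamma> has_vector_derivative cubic_field a b \<theta> (clamp_coords R (\<gamma> t))) (at t))"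
proof (rule truncated_cubic_field_bounded_lipschitz[of a b \<theta> R])
  fix C assume C: "\<And>z w. norm (cubic_field a b \<theta> (clamp_coords R z)) \<le> C"
    "\<And>z w. norm (cubic_field a b \<theta> (clamp_coords R z) - cubic_field a b \<theta> (clamp_coords R w)) \<le> C * norm (z - w)"
  have "C-lipschitz_on UNIV (\<lambda>z. cubic_field a b \<theta> (clamp_coords R z))"
    using C order_trans[OF norm_ge_zero C(1)] by (intro lipschitz_onI) (auto simp: dist_norm)
  from continuous_on_compose2[OF lipschitz_on_continuous_on[OF this], of UNIV snd]
  have "continuous_on UNIV (\<lambda>(t :: real, z). cubic_field a b \<theta> (clamp_coords R z))"
    by (simp add: case_prod_unfold continuous_on_snd continuous_on_id)
  then show ?thesis by (rule picard_global) (use C in auto)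
qed

text \<open>The field is only locally Lipschitz, but on a compact time interval both solutions stay
  in some ball, and a Lipschitz constant for that ball suffices.\<close>

lemma cubic_forward_unique:
  assumes \<gamma>: "solves_on (cubic_field a b \<theta>) \<gamma> {0..}" and \<delta>: "solves_on (cubic_field a b \<theta>) \<delta> {0..}"
    and "\<gamma> 0 = \<delta> 0" and t: "t \<ge> 0"
  shows "\<gamma> t = \<delta> t"
proof -
  have d: "(\<eta> has_vector_derivative cubic_field a b \<theta> (\<eta> s)) (at s within {0..t})"
    if "solves_on (cubic_field a b \<theta>) \<eta> {0..}" "s \<in> {0..t}" for \<eta> s
    using that unfolding solves_on_def
    by (auto intro!: has_vector_derivative_within_subset[of _ _ _ "{0..}" "{0..t}"])
  have "bounded (\<eta> ` {0..t})" if "solves_on (cubic_field a b \<theta>) \<eta> {0..}" for \<eta>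
    using d[OF that] by (intro compact_imp_bounded compact_continuous_image continuous_on_vector_derivative) auto
  from this[OF \<gamma>] this[OF \<delta>] obtain R1 R2
    where R: "\<forall>x\<in>\<gamma> ` {0..t}. norm x \<le> R1" "\<forall>x\<in>\<delta> ` {0..t}. norm x \<le> R2" unfolding bounded_iff by blast
  obtain L where L: "\<And>z w. norm z \<le> max R1 R2 \<Longrightarrow> norm w \<le> max R1 R2 \<Longrightarrow>
     norm (cubic_field a b \<theta> z - cubic_field a b \<theta> w) \<le> L * norm (z - w)"
    using cubic_field_lipschitz[of "max R1 R2" a b \<theta>] by blast
  show ?thesis
  proof (rule ode_unique_interval[where L = L and u' = "\<lambda>s. cubic_field a b \<theta> (\<gamma> s)" and v' = "\<lambda>s. cubic_field a b \<theta> (\<delta> s)"])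
    show "t \<in> {0..t}" using t by simp
    show "norm (cubic_field a b \<theta> (\<gamma> s) - cubic_field a b \<theta> (\<delta> s)) \<le> L * norm (\<gamma> s - \<delta> s)" if "s \<in> {0..t}" for s
      using R that by (intro L) (auto intro: le_max_iff_disj[THEN iffD2])
  qed (use d[OF \<gamma>] d[OF \<delta>] \<open>\<gamma> 0 = \<delta> 0\<close> in auto)
qed

section \<open>Energy estimates and stability at the origin\<close>

definition lienard_energy :: "real \<Rightarrow> real \<Rightarrow> real^2 \<Rightarrow> real" where
  "lienard_energy a b z = (z $ 2)\<^sup>2 / 2 + (z $ 1)\<^sup>2 / 2 + a * (z $ 1) ^ 3 / 3 + b * (z $ 1) ^ 4 / 4"

lemma lienard_energy_derivative:
  assumes "(\<gamma> has_vector_derivative cubic_field a b \<theta> (\<gamma> t)) (at t within S)"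
  shows "((\<lambda>t. lienard_energy a b (\<gamma> t)) has_real_derivative
    (\<theta> - (\<gamma> t $ 1)\<^sup>2) * (\<gamma> t $ 2)\<^sup>2) (at t within S)"
proof -
  have x: "((\<lambda>t. \<gamma> t $ 1) has_real_derivative \<gamma> t $ 2) (at t within S)"
    and y: "((\<lambda>t. \<gamma> t $ 2) has_real_derivative
      - ((\<gamma> t $ 1)\<^sup>2 - \<theta>) * \<gamma> t $ 2 - (\<gamma> t $ 1 + a * (\<gamma> t $ 1)\<^sup>2 + b * (\<gamma> t $ 1) ^ 3)) (at t within S)"
    using assms by (auto simp: has_vector_derivative_real2_iff cubic_field_def)
  show ?thesis unfolding lienard_energy_def
    apply (rule derivative_eq_intros refl x y | simp)+
    apply (simp add: algebra_simps power2_eq_square power3_eq_cube)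
    done
qed

lemma higher_order_small:
  fixes a b x :: real
  assumes x: "\<bar>x\<bar> \<le> R" and R: "R \<le> 1" "R * (\<bar>a\<bar> + \<bar>b\<bar>) \<le> c"
  shows "\<bar>a * x ^ 3\<bar> + \<bar>b * x ^ 4\<bar> \<le> c * x\<^sup>2"
proof -
  have "\<bar>a * x ^ 3\<bar> + \<bar>b * x ^ 4\<bar> = x\<^sup>2 * (\<bar>x\<bar> * (\<bar>a\<bar> + \<bar>b\<bar> * \<bar>x\<bar>))"
    by (simp add: abs_mult power2_eq_square power3_eq_cube power4_eq_xxxx algebra_simps)
  also have "\<dots> \<le> x\<^sup>2 * (R * (\<bar>a\<bar> + \<bar>b\<bar> * 1))"
    using x R(1) by (intro mult_left_mono mult_mono add_mono) auto
  also have "\<dots> \<le> x\<^sup>2 * c" using R(2) by (intro mult_left_mono) auto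
  finally show ?thesis by (simp add: mult.commute)
qed

text \<open>The cubic and quartic terms are bounded by x^2/4, which is half of the quadratic term
  x^2/2.\<close>

lemma lienard_energy_bounds:
  assumes z: "norm z \<le> R" and R: "R \<le> 1" "R * (\<bar>a\<bar> + \<bar>b\<bar>) \<le> 1/4"
  shows "(norm z)\<^sup>2 / 4 \<le> lienard_energy a b z" "lienard_energy a b z \<le> (norm z)\<^sup>2 * (3/4)"
proof -
  have "\<bar>z $ 1\<bar> \<le> R" using component_le_norm_cart[of z 1] z by simp
  from higher_order_small[OF this R]
  have "\<bar>a * (z $ 1) ^ 3\<bar> + \<bar>b * (z $ 1) ^ 4\<bar> \<le> 1/4 * (z $ 1)\<^sup>2" .
  moreover have "(z $ 2)\<^sup>2 \<ge> 0" by simp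
  ultimately show "(norm z)\<^sup>2 / 4 \<le> lienard_energy a b z" "lienard_energy a b z \<le> (norm z)\<^sup>2 * (3/4)"
    unfolding lienard_energy_def norm_real2_sq distrib_right add_divide_distrib by - linarith+
qed

lemma small_radius_exists:
  fixes K c :: real
  assumes "c > 0" "K \<ge> 0"
  shows "\<exists>R>0. R \<le> 1 \<and> R * K \<le> c"
proof (intro exI[of _ "min 1 (c / (K + 1))"] conjI)
  have "min 1 (c / (K + 1)) * K \<le> c / (K + 1) * (K + 1)"
    using assms by (intro mult_mono) auto
  then show "min 1 (c / (K + 1)) * K \<le> c" using assms by simp
qed (use assms in auto)

lemma continuous_on_subset_deriv:
  assumes "\<And>t. t \<in> T \<Longrightarrow> (f has_real_derivative f' t) (at t within S)" "T \<subseteq> S"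
  shows "continuous_on T f"
proof (rule DERIV_continuous_on)
  fix t assume "t \<in> T"
  show "(f has_real_derivative f' t) (at t within T)"
    using assms(1)[OF \<open>t \<in> T\<close>] assms(2) by (rule has_field_derivative_subset)
qed

text \<open>The energy does not increase and is comparable to the squared norm with constants 1/4
  and 3/4. Starting below r/2 gives |z|^2 <= 4 * (3/4) * (r/2)^2 = 3 r^2/4 < r^2, which closes the
  bootstrap.\<close>

lemma nonpositive_stable:
  assumes \<theta>: "\<theta> \<le> 0"
  shows "lyapunov_stable (cubic_field a b \<theta>) 0"
  unfolding lyapunov_stable_def
proof (intro allI impI)
  fix \<epsilon> :: real assume "\<epsilon> > 0"
  obtain R where R: "R > 0" "R \<le> 1" "R * (\<bar>a\<bar> + \<bar>b\<bar>) \<le> 1/4"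
    using small_radius_exists[of "1/4" "\<bar>a\<bar> + \<bar>b\<bar>"] by auto
  define r where "r = min \<epsilon> R"
  have r: "r > 0" "r \<le> \<epsilon>" "r \<le> 1" "r \<le> R" using R \<open>\<epsilon> > 0\<close> by (auto simp: r_def)
  have rab: "r * (\<bar>a\<bar> + \<bar>b\<bar>) \<le> 1/4" using mult_right_mono[OF r(4), of "\<bar>a\<bar> + \<bar>b\<bar>"] R(3) by simp
  \<comment> \<open>The equation is assumed only while the norm is at most \<open>r\<close>. Thus
    the estimate applies to any forward solution and also to the truncated one, and for the latter
    it shows that a forward solution exists.\<close>
  have bound: "norm (\<gamma> t) < r"
    if d: "\<And>t. t \<ge> 0 \<Longrightarrow> norm (\<gamma> t) \<le> r \<Longrightarrow> (\<gamma> has_vector_derivative cubic_field a b \<theta> (\<gamma> t)) (at t within {0..})"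
      and c: "continuous_on {0..} \<gamma>" and q: "norm (\<gamma> 0) < r / 2" and t: "t \<ge> 0" for \<gamma> t
  proof (rule continuity_bootstrap[where n = "\<lambda>t. norm (\<gamma> t)" and a = 0])
    show "continuous_on {0..} (\<lambda>t. norm (\<gamma> t))" by (intro continuous_intros c)
    show "norm (\<gamma> 0) < r" using q r by simp
    fix t :: real assume t: "t \<ge> 0" and le: "\<And>s. s \<in> {0..t} \<Longrightarrow> norm (\<gamma> s) \<le> r"
    let ?H = "\<lambda>s. lienard_energy a b (\<gamma> s)"
    have H: "(?H has_real_derivative (\<theta> - (\<gamma> s $ 1)\<^sup>2) * (\<gamma> s $ 2)\<^sup>2) (at s within {0..})" if "s \<in> {0..t}" for s
      using that le by (intro lienard_energy_derivative d) auto
    have "?H 0 \<ge> ?H t"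
    proof (rule DERIV_nonpos_imp_decreasing_open[of 0 t ?H, OF t])
      show "continuous_on {0..t} ?H"
        using H by (rule continuous_on_subset_deriv) auto
      fix s :: real assume s: "0 < s" "s < t"
      then have "at s within {0..} = at s" by (intro at_within_interior) simp
      moreover have "(\<theta> - (\<gamma> s $ 1)\<^sup>2) * (\<gamma> s $ 2)\<^sup>2 \<le> 0"
        using \<theta> by (intro mult_nonpos_nonneg) (auto intro: order_trans)
      ultimately show "\<exists>y. (?H has_real_derivative y) (at s) \<and> y \<le> 0" using H[of s] s by auto
    qed
    moreover have "(norm (\<gamma> t))\<^sup>2 / 4 \<le> ?H t" using t by (intro lienard_energy_bounds[OF le r(3) rab]) simp
    moreover have "?H 0 \<le> (norm (\<gamma> 0))\<^sup>2 * (3/4)" using t by (intro lienard_energy_bounds[OF le r(3) rab]) simp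
    moreover have "(norm (\<gamma> 0))\<^sup>2 \<le> (r / 2)\<^sup>2" using q by (intro power_mono) auto
    ultimately have "(norm (\<gamma> t))\<^sup>2 \<le> r\<^sup>2 * (3/4)" by (simp add: power_divide)
    also have "\<dots> < r\<^sup>2" using r by simp
    finally show "norm (\<gamma> t) < r" using r by (simp add: power_less_imp_less_base)
  qed (use t in auto)
  show "\<exists>\<delta>>0. \<forall>q. dist q 0 < \<delta> \<longrightarrow> (\<exists>\<gamma>. forward_solution (cubic_field a b \<theta>) q \<gamma>) \<and>
        (\<forall>\<gamma>. forward_solution (cubic_field a b \<theta>) q \<gamma> \<longrightarrow> (\<forall>t\<ge>0. dist (\<gamma> t) 0 < \<epsilon>))"
  proof (intro exI[of _ "r / 2"] conjI allI impI)
    show "r / 2 > 0" using r by simp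
    fix q :: "real^2" assume q: "dist q 0 < r / 2"
    obtain \<gamma> where \<gamma>: "\<gamma> 0 = q" "\<And>t. (\<gamma> has_vector_derivative cubic_field a b \<theta> (clamp_coords r (\<gamma> t))) (at t)"
      using truncated_solution_exists[of q a b \<theta> r] by blast
    have "continuous_on {0..} \<gamma>"
      using \<gamma>(2) by (meson continuous_at_imp_continuous_on has_vector_derivative_continuous)
    moreover have d: "(\<gamma> has_vector_derivative cubic_field a b \<theta> (\<gamma> t)) (at t within {0..})" if "norm (\<gamma> t) \<le> r" for t
      using \<gamma>(2)[of t] unfolding clamp_coords_id[OF that] by (rule has_vector_derivative_at_within)
    ultimately have "norm (\<gamma> t) < r" if "t \<ge> 0" for t
      using that q \<gamma>(1) by (intro bound) auto
    then have "forward_solution (cubic_field a b \<theta>) q \<gamma>"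
      using \<gamma>(1) d by (auto simp: forward_solution_def solves_on_def less_imp_le)
    then show "\<exists>\<gamma>. forward_solution (cubic_field a b \<theta>) q \<gamma>" by blast
  next
    fix q :: "real^2" and \<gamma> :: "real \<Rightarrow> real^2" and t :: real
    assume q: "dist q 0 < r / 2" and \<gamma>: "forward_solution (cubic_field a b \<theta>) q \<gamma>" and t: "t \<ge> 0"
    then have d: "(\<gamma> has_vector_derivative cubic_field a b \<theta> (\<gamma> t)) (at t within {0..})" if "t \<ge> 0" for t
      using that by (auto simp: forward_solution_def solves_on_def)
    have "norm (\<gamma> t) < r"
    proof (rule bound[OF d _ _ t])
      show "continuous_on {0..} \<gamma>" using d by (intro continuous_on_vector_derivative) auto
      show "norm (\<gamma> 0) < r / 2" using q \<gamma> by (simp add: forward_solution_def)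
    qed
    then show "dist (\<gamma> t) 0 < \<epsilon>" using r by simp
  qed
qed

text \<open>
  The cross term \<open>- c x y\<close> turns the semidefinite energy production into a definite one, so that \<open>V\<close> grows
  exponentially as long as the trajectory stays near the origin.
\<close>

lemma positive_unstable:
  assumes \<theta>: "\<theta> > 0"
  shows "\<not> lyapunov_stable (cubic_field a b \<theta>) 0"
proof
  assume st: "lyapunov_stable (cubic_field a b \<theta>) 0"
  \<comment> \<open>Within \<open>R\<close> the nonlinear forces are small against x, and x^2 is at
    most \<open>\<theta> / 4\<close>, so the damping is negative there.\<close>
  obtain R where R: "R > 0" "R \<le> 1" "R * (\<bar>a\<bar> + \<bar>b\<bar> + 1) \<le> min (1/4) (\<theta> / 4)"
    using small_radius_exists[of "min (1/4) (\<theta> / 4)" "\<bar>a\<bar> + \<bar>b\<bar> + 1"] \<theta> by auto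
  have R': "R * (\<bar>a\<bar> + \<bar>b\<bar>) \<le> 1/4" "R \<le> \<theta> / 4"
  proof -
    have "R * (\<bar>a\<bar> + \<bar>b\<bar>) \<le> R * (\<bar>a\<bar> + \<bar>b\<bar> + 1)" "R * 1 \<le> R * (\<bar>a\<bar> + \<bar>b\<bar> + 1)"
      using R(1) by (intro mult_left_mono; simp)+
    then show "R * (\<bar>a\<bar> + \<bar>b\<bar>) \<le> 1/4" "R \<le> \<theta> / 4" using R(3) by auto
  qed
  \<comment> \<open>Chosen so that the y^2 terms caused by the cross term cost exactly
    \<open>\<theta> / 4\<close>: of the coefficient \<open>3/4 * \<theta>\<close> there remains
    \<open>\<theta> / 2\<close>.\<close>
  define c where "c = \<theta> / (4 * (1 + (\<theta> + 1)\<^sup>2))"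
  have den: "1 + (\<theta> + 1)\<^sup>2 > 0" by (simp add: add_pos_nonneg)
  have c: "c > 0" using \<theta> den by (simp add: c_def)
  have c\<theta>: "c * (1 + (\<theta> + 1)\<^sup>2) = \<theta> / 4"
  proof -
    have "\<theta> / (4 * K) * K = \<theta> / 4" if "K > 0" for K :: real using that by simp
    from this[OF den] show ?thesis by (simp only: c_def)
  qed
  have c4: "c \<le> 1/4"
  proof -
    have "\<theta> \<le> 1 + (\<theta> + 1)\<^sup>2" using \<theta> by (simp add: power2_eq_square algebra_simps)
    moreover have "\<theta> / (4 * K) \<le> 1/4" if "\<theta> \<le> K" "K > 0" for K :: real using that by (simp add: field_simps)
    ultimately show ?thesis unfolding c_def using den by blast
  qed
  define V where "V z = lienard_energy a b z - c * (z $ 1) * (z $ 2)" for z :: "real^2"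
  define V' where "V' z = (\<theta> - (z $ 1)\<^sup>2) * (z $ 2)\<^sup>2 - c * (z $ 2)\<^sup>2
      - c * z $ 1 * (- ((z $ 1)\<^sup>2 - \<theta>) * z $ 2 - (z $ 1 + a * (z $ 1)\<^sup>2 + b * (z $ 1) ^ 3))" for z :: "real^2"
  have Vd: "((\<lambda>t. V (\<gamma> t)) has_real_derivative V' (\<gamma> t)) (at t within S)"
    if d: "(\<gamma> has_vector_derivative cubic_field a b \<theta> (\<gamma> t)) (at t within S)" for \<gamma> t S
  proof -
    have x: "((\<lambda>t. \<gamma> t $ 1) has_real_derivative \<gamma> t $ 2) (at t within S)"
      and y: "((\<lambda>t. \<gamma> t $ 2) has_real_derivative
        - ((\<gamma> t $ 1)\<^sup>2 - \<theta>) * \<gamma> t $ 2 - (\<gamma> t $ 1 + a * (\<gamma> t $ 1)\<^sup>2 + b * (\<gamma> t $ 1) ^ 3)) (at t within S)"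
      using d by (auto simp: has_vector_derivative_real2_iff cubic_field_def)
    show ?thesis unfolding V_def V'_def
      apply (rule derivative_eq_intros lienard_energy_derivative[OF d] refl x y)+
      apply (simp add: algebra_simps power2_eq_square)
      done
  qed
  have Vub: "V z \<le> 2 * (norm z)\<^sup>2" if "norm z \<le> R" for z
  proof -
    have "\<bar>z $ 1 * z $ 2\<bar> \<le> (norm z)\<^sup>2"
      using mult_mono[OF component_le_norm_cart[of z 1] component_le_norm_cart[of z 2]]
      by (simp add: abs_mult power2_eq_square)
    then have "\<bar>c * (z $ 1 * z $ 2)\<bar> \<le> 1/4 * (norm z)\<^sup>2"
      unfolding abs_mult[of c] using c c4 by (intro mult_mono) auto
    then have "- (c * (z $ 1 * z $ 2)) \<le> (norm z)\<^sup>2 / 4" by (simp add: abs_le_iff)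
    then show ?thesis
      using lienard_energy_bounds(2)[OF that R(2) R'(1)] zero_le_power2[of "norm z"]
      unfolding V_def mult.assoc by linarith
  qed
  have V'lb: "V' z \<ge> c / 8 * V z" if z: "norm z \<le> R" for z
  proof -
    define x y where "x = z $ 1" and "y = z $ 2"
    have xR: "\<bar>x\<bar> \<le> R" using component_le_norm_cart[of z 1] z by (simp add: x_def)
    have h: "\<bar>a * x ^ 3\<bar> + \<bar>b * x ^ 4\<bar> \<le> 1/4 * x\<^sup>2" by (rule higher_order_small[OF xR R(2) R'(1)])
    have x2: "x\<^sup>2 \<le> \<theta> / 4" "x\<^sup>2 \<le> 1"
    proof -
      have "x\<^sup>2 \<le> R * 1" unfolding power2_eq_square using mult_mono[OF xR order_trans[OF xR R(2)]] R(1)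
        by (simp add: abs_mult[symmetric])
      then show "x\<^sup>2 \<le> \<theta> / 4" "x\<^sup>2 \<le> 1" using R R' by auto
    qed
    have V'z: "V' z = (\<theta> - x\<^sup>2 - c) * y\<^sup>2 + c * (x\<^sup>2 + (a * x ^ 3 + b * x ^ 4)) + c * ((x\<^sup>2 - \<theta>) * (x * y))"
      unfolding V'_def x_def[symmetric] y_def[symmetric]
      by (simp add: power2_eq_square power3_eq_cube power4_eq_xxxx algebra_simps)
    have m1: "(\<theta> - x\<^sup>2 - c) * y\<^sup>2 \<ge> (3/4 * \<theta> - c) * y\<^sup>2" using x2 by (intro mult_right_mono) auto
    have m2: "c * (x\<^sup>2 + (a * x ^ 3 + b * x ^ 4)) \<ge> c * (3/4 * x\<^sup>2)"
      using c h by (intro mult_left_mono) (auto simp: abs_le_iff)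
    have "\<bar>(x\<^sup>2 - \<theta>) * (x * y)\<bar> \<le> x\<^sup>2 / 4 + (\<theta> + 1)\<^sup>2 * y\<^sup>2"
    proof -
      have "\<bar>(x\<^sup>2 - \<theta>) * (x * y)\<bar> \<le> (\<theta> + 1) * (\<bar>x\<bar> * \<bar>y\<bar>)"
      proof -
        have "\<bar>x\<^sup>2 - \<theta>\<bar> \<le> \<theta> + 1" using x2 \<theta> zero_le_power2[of x] by linarith
        then show ?thesis unfolding abs_mult by (intro mult_right_mono) auto
      qed
      \<comment> \<open>Young's inequality with unequal weights: the share x^2/4 leaves half of c
        x^2 from the restoring force, and the large weight falls on y^2, where c was chosen to
        absorb it.\<close>
      also have "\<dots> \<le> x\<^sup>2 / 4 + (\<theta> + 1)\<^sup>2 * y\<^sup>2"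
      proof -
        have "k * (\<bar>x\<bar> * \<bar>y\<bar>) \<le> x\<^sup>2 / 4 + k\<^sup>2 * y\<^sup>2" for k
          using sum_squares_bound[of "\<bar>x\<bar> / 2" "k * \<bar>y\<bar>"] by (simp add: power_mult_distrib power_divide mult_ac)
        then show ?thesis .
      qed
      finally show ?thesis .
    qed
    then have "c * - ((x\<^sup>2 - \<theta>) * (x * y)) \<le> c * (x\<^sup>2 / 4 + (\<theta> + 1)\<^sup>2 * y\<^sup>2)"
      using c by (intro mult_left_mono) auto
    then have m3: "c * ((x\<^sup>2 - \<theta>) * (x * y)) \<ge> - (c * x\<^sup>2 / 4) - (c * (\<theta> + 1)\<^sup>2) * y\<^sup>2"
      by (simp add: algebra_simps)
    have "V' z \<ge> (3/4 * \<theta> - c * (1 + (\<theta> + 1)\<^sup>2)) * y\<^sup>2 + c * x\<^sup>2 / 2"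
      using m1 m2 m3 unfolding V'z by (simp add: algebra_simps)
    then have "V' z \<ge> \<theta> / 2 * y\<^sup>2 + c * x\<^sup>2 / 2" unfolding c\<theta> by simp
    moreover have "\<theta> / 2 * y\<^sup>2 \<ge> c / 4 * y\<^sup>2"
    proof (rule mult_right_mono)
      have "c * 1 \<le> c * (1 + (\<theta> + 1)\<^sup>2)" using c by (intro mult_left_mono) auto
      then show "c / 4 \<le> \<theta> / 2" unfolding c\<theta> using c \<theta> by simp
    qed simp
    moreover have "c * x\<^sup>2 / 2 \<ge> c / 4 * x\<^sup>2" using c by simp
    ultimately have "V' z \<ge> c / 4 * (x\<^sup>2 + y\<^sup>2)" by (simp add: distrib_left)
    moreover have "c / 4 * (x\<^sup>2 + y\<^sup>2) = c / 8 * (2 * (norm z)\<^sup>2)" by (simp add: norm_real2_sq x_def y_def)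
    moreover have "c / 8 * (2 * (norm z)\<^sup>2) \<ge> c / 8 * V z" using Vub[OF z] c by (intro mult_left_mono) auto
    ultimately show ?thesis by linarith
  qed
  obtain \<delta> where \<delta>: "\<delta> > 0" and st': "\<And>q. dist q 0 < \<delta> \<Longrightarrow>
        (\<exists>\<gamma>. forward_solution (cubic_field a b \<theta>) q \<gamma>) \<and>
        (\<forall>\<gamma>. forward_solution (cubic_field a b \<theta>) q \<gamma> \<longrightarrow> (\<forall>t\<ge>0. dist (\<gamma> t) 0 < R))"
    using st R(1) unfolding lyapunov_stable_def by meson
  \<comment> \<open>On the y-axis the cross term and the potential vanish, so \<open>V\<close> is
    positive arbitrarily close to the origin.\<close>
  define q :: "real^2" where "q = vector [0, \<delta> / 2]"
  have "norm q \<le> \<delta> / 2" using norm_real2_le[of q] \<delta> by (simp add: q_def)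
  then have "dist q 0 < \<delta>" using \<delta> by simp
  then obtain \<gamma> where \<gamma>: "forward_solution (cubic_field a b \<theta>) q \<gamma>" and \<gamma>R: "\<And>t. t \<ge> 0 \<Longrightarrow> norm (\<gamma> t) < R"
    using st'[of q] by auto
  have V0: "V (\<gamma> 0) > 0" using \<gamma> \<delta> by (simp add: forward_solution_def q_def V_def lienard_energy_def)
  have D: "((\<lambda>t. V (\<gamma> t)) has_real_derivative V' (\<gamma> t)) (at t within {0..})" if "t \<ge> 0" for t
    using \<gamma> that by (intro Vd) (auto simp: forward_solution_def solves_on_def)
  define E where "E t = exp (- (c / 8) * t) * V (\<gamma> t)" for t
  have E: "E 0 \<le> E t" if "t \<ge> 0" for t
  proof (rule DERIV_nonneg_imp_increasing_open[of 0 t E, OF that])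
    have ED: "(E has_real_derivative exp (- (c / 8) * s) * (V' (\<gamma> s) - c / 8 * V (\<gamma> s))) (at s within {0..})" if "s \<ge> 0" for s
      unfolding E_def using D[OF that] by (auto intro!: derivative_eq_intros simp: algebra_simps)
    show "continuous_on {0..t} E"
      by (rule continuous_on_subset_deriv[OF ED]) auto
    fix s :: real assume s: "0 < s" "s < t"
    then have "at s within {0..} = at s" by (intro at_within_interior) simp
    moreover have "exp (- (c / 8) * s) * (V' (\<gamma> s) - c / 8 * V (\<gamma> s)) \<ge> 0"
      using V'lb[of "\<gamma> s"] \<gamma>R[of s] s by simp
    ultimately show "\<exists>y. (E has_real_derivative y) (at s) \<and> 0 \<le> y" using ED[of s] s by auto
  qed
  \<comment> \<open>By exp s >= 1 + s, growth up to this time already exceeds the bound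
    \<open>2 * R\<^sup>2\<close> that staying within \<open>R\<close> would impose.\<close>
  define t where "t = 8 / c * (2 * R\<^sup>2 / V (\<gamma> 0))"
  have t: "t \<ge> 0" using c V0 by (simp add: t_def)
  have "V (\<gamma> 0) * exp (c / 8 * t) \<le> V (\<gamma> t)"
  proof -
    have "exp (c / 8 * t) * V (\<gamma> 0) \<le> exp (c / 8 * t) * (exp (- (c / 8) * t) * V (\<gamma> t))"
      using E[OF t] by (intro mult_left_mono) (simp_all add: E_def)
    moreover have "exp (c / 8 * t) * (exp (- (c / 8) * t) * v) = v" for v
      by (simp only: mult.assoc[symmetric] exp_add[symmetric]) simp
    ultimately show ?thesis by (simp only: mult.commute[of "V (\<gamma> 0)"])
  qed
  moreover have "V (\<gamma> 0) * exp (c / 8 * t) \<ge> V (\<gamma> 0) * (1 + c / 8 * t)"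
  proof (rule mult_left_mono[OF exp_ge_add_one_self])
    show "0 \<le> V (\<gamma> 0)" using V0 by simp
  qed
  moreover have "V (\<gamma> 0) * (1 + c / 8 * t) = V (\<gamma> 0) + 2 * R\<^sup>2"
  proof -
    have "c / 8 * t = 2 * R\<^sup>2 / V (\<gamma> 0)" using c by (simp add: t_def)
    then show ?thesis using V0 by (simp add: distrib_left)
  qed
  moreover have "V (\<gamma> t) \<le> 2 * R\<^sup>2"
  proof -
    have "(norm (\<gamma> t))\<^sup>2 \<le> R\<^sup>2" using \<gamma>R[OF t] by (intro power_mono) auto
    then show ?thesis using Vub[of "\<gamma> t"] \<gamma>R[OF t] by simp
  qed
  ultimately show False using V0 by linarith
qed

section \<open>Linear part at the origin\<close>

lemma cubic_field_derivative_0: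
  "(cubic_field a b \<theta> has_derivative (\<lambda>h. vector [h $ 2, \<theta> * h $ 2 - h $ 1])) (at 0)"
proof -
  have nth: "((\<lambda>z :: real^2. z $ i) has_derivative (\<lambda>h. h $ i)) (at 0)" for i
    by (rule bounded_linear.has_derivative[OF bounded_linear_vec_nth has_derivative_ident])
  show ?thesis
    unfolding cubic_field_def[abs_def] vector2_axis
    by (rule derivative_eq_intros nth refl | simp)+
qed

text \<open>The characteristic polynomial is mu^2 - theta mu + 1. For small theta its roots are
  complex with real part theta/2, and exhibiting one of them with eigenvector (1, mu) is
  enough.\<close>

lemma source_imp_pos:
  assumes "source (cubic_field a b \<theta>) 0" and small: "\<bar>\<theta>\<bar> < 1"
  shows "\<theta> > 0"
proof -
  define A where "A = jacobian (cubic_field a b \<theta>) (at 0)"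
  have A: "A = matrix (\<lambda>h. vector [h $ 2, \<theta> * h $ 2 - h $ 1])"
    unfolding A_def jacobian_def using frechet_derivative_at[OF cubic_field_derivative_0[of a b \<theta>]] by simp
  have Aij: "A $ 1 $ 1 = 0" "A $ 1 $ 2 = 1" "A $ 2 $ 1 = - 1" "A $ 2 $ 2 = \<theta>"
    unfolding A matrix_def by (simp_all add: axis_def)
  define \<mu> where "\<mu> = Complex (\<theta> / 2) (sqrt (1 - \<theta>\<^sup>2 / 4))"
  have "\<theta>\<^sup>2 \<le> 1" using small by (simp add: abs_square_le_1)
  then have "(sqrt (1 - \<theta>\<^sup>2 / 4))\<^sup>2 = 1 - \<theta>\<^sup>2 / 4" by (intro real_sqrt_pow2) simp
  then have \<mu>: "- 1 + of_real \<theta> * \<mu> = \<mu> * \<mu>"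
    by (simp add: \<mu>_def complex_eq_iff power2_eq_square algebra_simps)
  define v :: "complex^2" where "v = vector [1, \<mu>]"
  have "v \<noteq> 0" by (simp add: v_def vec_eq_iff forall_2)
  moreover have "map_matrix complex_of_real A *v v = \<mu> *s v"
    using \<mu> by (simp add: vec_eq_iff forall_2 matrix_vector_mult_def map_matrix_def sum_2 Aij v_def)
  ultimately have "complex_eigenvalue A \<mu>" unfolding complex_eigenvalue_def by blast
  then have "Re \<mu> > 0" using assms unfolding source_def A_def by blast
  then show ?thesis by (simp add: \<mu>_def)
qed

section \<open>The limit cycle\<close>

lemma periodic_range:
  fixes f :: "real \<Rightarrow> 'a"
  assumes f: "\<And>t. f (t + T) = f t" and T: "T > 0"
  shows "range f = f ` {0..T}"
proof
  show "range f \<subseteq> f ` {0..T}"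
  proof
    fix y assume "y \<in> range f"
    then obtain t where t: "y = f t" by blast
    define s where "s = t + of_int (- \<lfloor>t / T\<rfloor>) * T"
    have "s = T * frac (t / T)" using T by (simp add: s_def frac_def field_simps)
    then have "s \<in> {0..T}"
      using T frac_ge_0[of "t / T"] frac_lt_1[of "t / T"] by (auto simp: mult_le_cancel_left1)
    moreover have "f s = y" unfolding s_def periodic_int_multiple[of f T, OF f] t ..
    ultimately show "y \<in> f ` {0..T}" by blast
  qed
qed auto

lemma solves_on_continuous:
  assumes "solves_on f \<gamma> S"
  shows "continuous_on S \<gamma>"
  using assms unfolding solves_on_def by (intro continuous_on_vector_derivative) blast

lemma solves_on_shift:
  assumes "solves_on f \<gamma> UNIV"
  shows "solves_on f (\<lambda>t. \<gamma> (t + s)) UNIV"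
proof -
  have "((\<gamma> \<circ> (\<lambda>t. t + s)) has_vector_derivative 1 *\<^sub>R f (\<gamma> (t + s))) (at t)" for t
    using assms by (intro vector_diff_chain_at) (auto intro!: derivative_eq_intros simp: solves_on_def)
  then show ?thesis by (simp add: solves_on_def o_def)
qed

text \<open>A periodic orbit that attracts a neighbourhood is automatically isolated: a second periodic orbit
  meeting the neighbourhood would have distance tending to zero, hence be contained in the first.\<close>

lemma attracting_orbit_limit_cycle:
  fixes f :: "'a::real_inner \<Rightarrow> 'a"
  assumes lip: "\<And>R. \<exists>L. \<forall>z w. norm z \<le> R \<longrightarrow> norm w \<le> R \<longrightarrow> norm (f z - f w) \<le> L * norm (z - w)"
    and \<Gamma>: "periodic_orbit f \<Gamma>" and \<delta>: "\<delta> > 0"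
    and attr: "\<And>q. infdist q \<Gamma> < \<delta> \<Longrightarrow>
        (\<exists>\<gamma>. forward_solution f q \<gamma>) \<and>
        (\<forall>\<gamma>. forward_solution f q \<gamma> \<longrightarrow> ((\<lambda>t. infdist (\<gamma> t) \<Gamma>) \<longlongrightarrow> 0) at_top)"
  shows "stable_limit_cycle f \<Gamma>"
proof -
  obtain \<gamma> T where \<gamma>: "solves_on f \<gamma> UNIV" "T > 0" "\<And>t. \<gamma> (t + T) = \<gamma> t" "\<Gamma> = range \<gamma>"
    using \<Gamma> unfolding periodic_orbit_def by blast
  have "compact \<Gamma>" unfolding \<gamma>(4) periodic_range[of \<gamma> T, OF \<gamma>(3,2)]
    by (intro compact_continuous_image continuous_on_subset[OF solves_on_continuous[OF \<gamma>(1)]]) auto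
  then have \<Gamma>': "closed \<Gamma>" "bounded \<Gamma>" "\<Gamma> \<noteq> {}"
    using \<gamma>(4) by (auto intro: compact_imp_closed compact_imp_bounded)
  have "\<Gamma>1 = \<Gamma>" if \<Gamma>1: "periodic_orbit f \<Gamma>1" and q: "q \<in> \<Gamma>1" "infdist q \<Gamma> < \<delta>" for \<Gamma>1 q
  proof -
    obtain g S where g: "solves_on f g UNIV" "S > 0" "\<And>t. g (t + S) = g t" "\<Gamma>1 = range g"
      using \<Gamma>1 unfolding periodic_orbit_def by blast
    obtain s where s: "q = g s" using q g by blast
    have "forward_solution f q (\<lambda>t. g (t + s))"
      using solves_on_shift[OF g(1), of s] by (auto simp: forward_solution_def s solves_on_def has_vector_derivative_at_within)
    then have lim: "((\<lambda>t. infdist (g (t + s)) \<Gamma>) \<longlongrightarrow> 0) at_top" using attr[OF q(2)] by blast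
    \<comment> \<open>Along the times u - s + nS the second orbit always sits at the same point, so
      its constant distance to the first orbit must equal the limit 0.\<close>
    have in\<Gamma>: "g u \<in> \<Gamma>" for u
    proof -
      have "filterlim (\<lambda>n. (u - s) + S * real n) at_top sequentially"
        by (intro filterlim_tendsto_add_at_top[OF tendsto_const]
          filterlim_tendsto_pos_mult_at_top[OF tendsto_const g(2) filterlim_real_sequentially])
      from filterlim_compose[OF lim this]
      have "(\<lambda>n. infdist (g ((u - s) + S * real n + s)) \<Gamma>) \<longlonglongrightarrow> 0" .
      moreover have "g ((u - s) + S * real n + s) = g u" for n
        using periodic_int_multiple[of g S u "int n", OF g(3)] by (simp add: algebra_simps)
      ultimately have "(\<lambda>n::nat. infdist (g u) \<Gamma>) \<longlonglongrightarrow> 0" by simp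
      then have "infdist (g u) \<Gamma> = 0" by (simp add: LIMSEQ_const_iff)
      then show ?thesis using \<Gamma>' in_closed_iff_infdist_zero by blast
    qed
    obtain R where R: "\<And>x. x \<in> \<Gamma> \<Longrightarrow> norm x \<le> R" using \<Gamma>'(2) unfolding bounded_iff by blast
    obtain L where L: "\<And>z w. norm z \<le> R \<Longrightarrow> norm w \<le> R \<Longrightarrow> norm (f z - f w) \<le> L * norm (z - w)"
      using lip by blast
    obtain s0 where s0: "g 0 = \<gamma> s0" using in\<Gamma>[of 0] \<gamma>(4) by auto
    \<comment> \<open>Containment alone is weaker than equality; uniqueness shows that the second
      orbit is a time shift of the first.\<close>
    have eq: "g u = \<gamma> (u + s0)" for u
    proof (rule ode_unique_line[where u = g and v = "\<lambda>u. \<gamma> (u + s0)" and a = 0 and L = L])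
      show "(g has_vector_derivative f (g t)) (at t)" for t using g(1) by (simp add: solves_on_def)
      show "((\<lambda>u. \<gamma> (u + s0)) has_vector_derivative f (\<gamma> (t + s0))) (at t)" for t
        using solves_on_shift[OF \<gamma>(1), of s0] by (simp add: solves_on_def)
      show "norm (f (g t) - f (\<gamma> (t + s0))) \<le> L * norm (g t - \<gamma> (t + s0))" for t
        using in\<Gamma>[of t] \<gamma>(4) by (intro L R) auto
    qed (simp add: s0)
    have "\<gamma> u = g (u - s0)" for u using eq[of "u - s0"] by simp
    then have "\<Gamma> \<subseteq> \<Gamma>1" unfolding \<gamma>(4) g(4) by auto
    moreover have "\<Gamma>1 \<subseteq> \<Gamma>" unfolding g(4) using in\<Gamma> by auto
    ultimately show ?thesis by blast
  qed
  then have "limit_cycle f \<Gamma>" unfolding limit_cycle_def using \<Gamma> \<delta> by blast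
  then show ?thesis unfolding stable_limit_cycle_def using \<delta> attr by blast
qed

section \<open>From the angle back to time\<close>

definition polar_point :: "real \<Rightarrow> real \<Rightarrow> real \<Rightarrow> real^2" where
  "polar_point m r p = vector [m * (r * cos p), m * (- r * sin p)]"

text \<open>By the chain rule, a radius given as a function of the angle, run through at the polar
  speed, solves the planar system; the factor m undoes the rescaling and turns the parameter into
  m^2.\<close>

lemma polar_point_solution:
  assumes \<rho>: "(\<rho> has_real_derivative polar_slope a b m (\<phi> t) (\<rho> (\<phi> t))) (at (\<phi> t))"
    and \<phi>: "(\<phi> has_real_derivative polar_speed a b m (\<phi> t) (\<rho> (\<phi> t))) (at t within S)"
    and \<omega>: "polar_speed a b m (\<phi> t) (\<rho> (\<phi> t)) \<noteq> 0"
  shows "((\<lambda>t. polar_point m (\<rho> (\<phi> t)) (\<phi> t)) has_vector_derivative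
    cubic_field a b (m\<^sup>2) (polar_point m (\<rho> (\<phi> t)) (\<phi> t))) (at t within S)"
proof -
  note XY = polar_coordinates_derivative[OF \<rho>] and c = polar_slope_cartesian[OF \<omega>]
  define x y where "x = \<rho> (\<phi> t) * cos (\<phi> t)" and "y = - \<rho> (\<phi> t) * sin (\<phi> t)"
  have X: "((\<lambda>t. \<rho> (\<phi> t) * cos (\<phi> t)) has_real_derivative y) (at t within S)"
    using DERIV_chain2[OF XY(1) \<phi>] c(1) by (simp only: mult.commute y_def)
  have Y: "((\<lambda>t. - \<rho> (\<phi> t) * sin (\<phi> t)) has_real_derivative - x + m * hopf_pert a b m x y) (at t within S)"
    using DERIV_chain2[OF XY(2) \<phi>] c(2) by (simp only: mult.commute x_def y_def)
  have "m * (- x + m * hopf_pert a b m x y)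
      = - ((m * x)\<^sup>2 - m\<^sup>2) * (m * y) - (m * x + a * (m * x)\<^sup>2 + b * (m * x) ^ 3)"
    by (simp add: hopf_pert_def power2_eq_square power3_eq_cube algebra_simps)
  then show ?thesis
    using DERIV_cmult[OF X, of m] DERIV_cmult[OF Y, of m]
    by (simp add: has_vector_derivative_real2_iff cubic_field_def polar_point_def x_def y_def)
qed

text \<open>Once the radius is a function of the angle, the angle obeys an autonomous scalar
  equation, Lipschitz because the radius function is. The second conclusion supplies the constant
  for uniqueness of the phase.\<close>

lemma phase_exists:
  assumes speed: "\<And>p r. r \<in> {3/2..3} \<Longrightarrow> polar_speed a b m p r \<ge> 1/2"
    and \<rho>: "\<And>x y. \<bar>\<rho> x - \<rho> y\<bar> \<le> C * dist x y"
  shows "\<exists>\<phi>. \<phi> 0 = p0 \<and>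
    (\<forall>t. (\<phi> has_real_derivative polar_speed a b m (\<phi> t) (clamp_radius (\<rho> (\<phi> t)))) (at t))"
    and "\<exists>L. \<forall>x y. \<bar>polar_speed a b m x (clamp_radius (\<rho> x)) - polar_speed a b m y (clamp_radius (\<rho> y))\<bar> \<le> L * \<bar>x - y\<bar>"
proof -
  have id: "\<bar>x - y\<bar> \<le> 1 * dist x y" for x y :: real by (simp add: dist_real_def)
  have bl: "bounded_lipschitz (\<lambda>x. polar_speed a b m x (clamp_radius (\<rho> x)))"
    unfolding polar_speed_def clamp_radius_def
    by (intro bl_intros polar_pert_bl bounded_lipschitz_clamp[OF \<rho>] bounded_lipschitz_cos[OF id] bounded_lipschitz_sin[OF id])
  then obtain B where B: "\<And>x. \<bar>polar_speed a b m x (clamp_radius (\<rho> x))\<bar> \<le> B"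
    "\<And>x y. \<bar>polar_speed a b m x (clamp_radius (\<rho> x)) - polar_speed a b m y (clamp_radius (\<rho> y))\<bar> \<le> B * dist x y"
    unfolding bounded_lipschitz_def by blast
  have "continuous_on UNIV (\<lambda>(t :: real, x). polar_speed a b m x (clamp_radius (\<rho> x)))"
    using continuous_on_compose2[OF bounded_lipschitz_continuous[OF bl, of UNIV], of UNIV snd]
    by (simp add: case_prod_unfold continuous_on_snd continuous_on_id)
  then have "\<exists>\<phi>. \<phi> 0 = p0 \<and>
    (\<forall>t. (\<phi> has_vector_derivative polar_speed a b m (\<phi> t) (clamp_radius (\<rho> (\<phi> t)))) (at t))"
    by (rule picard_global[where L = B and B = B]) (use B in \<open>auto simp: dist_real_def\<close>)
  then show "\<exists>\<phi>. \<phi> 0 = p0 \<and>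
    (\<forall>t. (\<phi> has_real_derivative polar_speed a b m (\<phi> t) (clamp_radius (\<rho> (\<phi> t)))) (at t))"
    by (simp add: has_real_derivative_iff_has_vector_derivative)
  show "\<exists>L. \<forall>x y. \<bar>polar_speed a b m x (clamp_radius (\<rho> x)) - polar_speed a b m y (clamp_radius (\<rho> y))\<bar> \<le> L * \<bar>x - y\<bar>"
    using B(2) unfolding dist_real_def by blast
qed

lemma growth_at_least_half:
  fixes \<phi> :: "real \<Rightarrow> real"
  assumes \<phi>: "\<And>t. (\<phi> has_real_derivative \<phi>' t) (at t)" and "\<And>t. \<phi>' t \<ge> 1/2" and "s \<le> t"
  shows "\<phi> t \<ge> \<phi> s + (t - s) / 2"
proof -
  have "((\<lambda>u. \<phi> u - u / 2) has_real_derivative \<phi>' u - 1/2) (at u)" for u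
    using \<phi>[of u] by (auto intro!: derivative_eq_intros)
  then have "\<phi> s - s / 2 \<le> \<phi> t - t / 2"
    using assms(2) by (intro DERIV_nonneg_imp_nondecreasing[OF assms(3), of "\<lambda>u. \<phi> u - u / 2"]) (metis diff_ge_0_iff_ge)
  then show ?thesis by (simp add: diff_divide_distrib)
qed

text \<open>A speed of at least 1/2 carries the phase through every angle; the period and all points
  of the closed orbit are obtained from this.\<close>

lemma growth_surj:
  fixes \<phi> :: "real \<Rightarrow> real"
  assumes \<phi>: "\<And>t. (\<phi> has_real_derivative \<phi>' t) (at t)" and ge: "\<And>t. \<phi>' t \<ge> 1/2"
  shows "\<exists>t. \<phi> t = p"
proof -
  define t where "t = 2 * \<bar>p - \<phi> 0\<bar>"
  have "\<phi> (- t) \<le> p" using growth_at_least_half[OF \<phi> ge, of "- t" 0] by (simp add: t_def)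
  moreover have "p \<le> \<phi> t" using growth_at_least_half[OF \<phi> ge, of 0 t] by (simp add: t_def)
  moreover have "continuous_on {- t..t} \<phi>" using \<phi> by (meson DERIV_isCont continuous_at_imp_continuous_on)
  ultimately show ?thesis using IVT'[of \<phi> "- t" p t] by (auto simp: t_def)
qed

lemma polar_point_exists:
  assumes m: "m > 0" and z: "z \<noteq> (0 :: real^2)"
  shows "\<exists>p. z = polar_point m (norm z / m) p"
proof -
  have "(z $ 1 / norm z)\<^sup>2 + (- z $ 2 / norm z)\<^sup>2 = 1"
  proof -
    have "(z $ 1 / norm z)\<^sup>2 + (- z $ 2 / norm z)\<^sup>2 = ((z $ 1)\<^sup>2 + (z $ 2)\<^sup>2) / (norm z)\<^sup>2"
      by (simp add: power_divide add_divide_distrib)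
    then show ?thesis using z by (simp flip: norm_real2_sq)
  qed
  from sincos_total_2pi_le[OF this] obtain p where "z $ 1 / norm z = cos p" "- z $ 2 / norm z = sin p" by blast
  then have "norm z * cos p = z $ 1" "norm z * sin p = - z $ 2" using z by (auto simp: field_simps)
  then have "z = polar_point m (norm z / m) p"
    using m by (simp add: polar_point_def vec_eq_iff forall_2)
  then show ?thesis by blast
qed

lemma norm_polar_point:
  assumes "m \<ge> 0" "r \<ge> 0"
  shows "norm (polar_point m r p) = m * r"
proof -
  have "(norm (polar_point m r p))\<^sup>2 = (m * r)\<^sup>2 * ((cos p)\<^sup>2 + (sin p)\<^sup>2)"
    unfolding norm_real2_sq polar_point_def vector_2 by algebra
  then have "(norm (polar_point m r p))\<^sup>2 = (m * r)\<^sup>2" by simp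
  then show ?thesis using assms by (simp add: power2_eq_iff_nonneg)
qed

lemma dist_polar_point:
  assumes "m \<ge> 0"
  shows "dist (polar_point m r p) (polar_point m r' p) = m * \<bar>r - r'\<bar>"
proof -
  have "polar_point m r p - polar_point m r' p = (r - r') *\<^sub>R polar_point m 1 p"
    by (simp add: polar_point_def vec_eq_iff forall_2 algebra_simps)
  then show ?thesis using norm_polar_point[OF assms, of 1 p] by (simp add: dist_norm)
qed

text \<open>Radial attraction at equal angle bounds the distance to the orbit as a set, so the time
  lag between two solutions does not matter.\<close>

lemma hopf_limit_cycle:
  assumes m: "m > 0"
    and ode: "annular_ode (polar_slope a b m) (polar_energy a b m) (polar_energy_rate a b m) \<kappa>"
    and speed: "\<And>p r. r \<in> {3/2..3} \<Longrightarrow> polar_speed a b m p r \<ge> 1/2"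
  shows "\<exists>\<Gamma>. stable_limit_cycle (cubic_field a b (m\<^sup>2)) \<Gamma>"
proof -
  interpret annular_ode "polar_slope a b m" "polar_energy a b m" "polar_energy_rate a b m" \<kappa> by (rule ode)
  let ?f = "cubic_field a b (m\<^sup>2)"
  have phase: "\<exists>\<phi>. \<phi> 0 = p0 \<and>
    (\<forall>t. (\<phi> has_real_derivative polar_speed a b m (\<phi> t) (clamp_radius (\<rho> (\<phi> t)))) (at t))" if "sol \<rho>" for \<rho> p0
    using sol_lipschitz[OF that] phase_exists(1)[OF speed] by blast
  have curve: "((\<lambda>t. polar_point m (\<rho> (\<phi> t)) (\<phi> t)) has_vector_derivative ?f (polar_point m (\<rho> (\<phi> t)) (\<phi> t))) (at t within S)"
    if \<rho>: "sol \<rho>" and \<phi>: "\<And>t. (\<phi> has_real_derivative polar_speed a b m (\<phi> t) (clamp_radius (\<rho> (\<phi> t)))) (at t)"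
      and r: "\<rho> (\<phi> t) \<in> {3/2..3}" for \<rho> \<phi> t S
  proof (rule polar_point_solution)
    show "(\<rho> has_real_derivative polar_slope a b m (\<phi> t) (\<rho> (\<phi> t))) (at (\<phi> t))"
      using \<rho> unfolding sol_def by (metis clamp_radius_id[OF r])
    show "(\<phi> has_real_derivative polar_speed a b m (\<phi> t) (\<rho> (\<phi> t))) (at t within S)"
      using \<phi>[of t] unfolding clamp_radius_id[OF r] by (rule has_field_derivative_at_within)
    show "polar_speed a b m (\<phi> t) (\<rho> (\<phi> t)) \<noteq> 0" using speed[OF r, of "\<phi> t"] by auto
  qed
  obtain \<rho> where \<rho>: "sol \<rho>" "\<And>p. \<rho> (p + 2 * pi) = \<rho> p" and
    \<rho>r: "\<And>p. \<rho> p \<in> {3/2<..<3}" and \<rho>V: "\<And>p. polar_energy a b m p (\<rho> p) \<in> {3/2..3}"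
    using periodic_sol_exists by blast
  have \<rho>r': "\<rho> p \<in> {3/2..3}" for p using \<rho>r[of p] by simp
  obtain \<phi> where \<phi>0: "\<phi> 0 = 0" and
    \<phi>: "\<And>t. (\<phi> has_real_derivative polar_speed a b m (\<phi> t) (clamp_radius (\<rho> (\<phi> t)))) (at t)"
    using phase[OF \<rho>(1), of 0] by blast
  have \<phi>ge: "polar_speed a b m (\<phi> t) (clamp_radius (\<rho> (\<phi> t))) \<ge> 1/2" for t by (rule speed[OF clamp_radius_mem])
  note surj = growth_surj[OF \<phi> \<phi>ge]
  define pt where "pt p = polar_point m (\<rho> p) p" for p
  define \<gamma> where "\<gamma> t = pt (\<phi> t)" for t
  define \<Gamma> where "\<Gamma> = range \<gamma>"
  have pt_\<Gamma>: "pt p \<in> \<Gamma>" for p using surj[of p] by (auto simp: \<Gamma>_def \<gamma>_def)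
  have pt_per: "pt (p + 2 * pi) = pt p" for p by (simp add: pt_def polar_point_def \<rho>(2))
  have \<gamma>: "solves_on ?f \<gamma> UNIV"
    unfolding solves_on_def \<gamma>_def pt_def using curve[OF \<rho>(1) \<phi> \<rho>r'] by blast
  obtain T where T: "\<phi> T = 2 * pi" using surj by blast
  have "T > 0"
  proof (rule ccontr)
    assume "\<not> T > 0"
    then have "\<phi> T \<le> 0" using growth_at_least_half[OF \<phi> \<phi>ge, of T 0] \<phi>0 by simp
    then show False using T pi_gt_zero by simp
  qed
  \<comment> \<open>Both sides solve the same phase equation, whose right-hand side is periodic in
    the angle, and they agree at time 0.\<close>
  have \<phi>T: "\<phi> (t + T) = \<phi> t + 2 * pi" for t
  proof -
    obtain C where C: "\<And>x y. \<bar>\<rho> x - \<rho> y\<bar> \<le> C * dist x y" using sol_lipschitz[OF \<rho>(1)] by blast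
    obtain L where L: "\<And>x y. \<bar>polar_speed a b m x (clamp_radius (\<rho> x)) - polar_speed a b m y (clamp_radius (\<rho> y))\<bar> \<le> L * \<bar>x - y\<bar>"
      using phase_exists(2)[OF speed C] by blast
    let ?s = "\<lambda>x. polar_speed a b m x (clamp_radius (\<rho> x))"
    have per: "?s (x + 2 * pi) = ?s x" for x by (simp add: polar_speed_def polar_pert_def \<rho>(2))
    show ?thesis
    proof (rule ode_unique_line[where u = "\<lambda>t. \<phi> (t + T)" and v = "\<lambda>t. \<phi> t + 2 * pi" and a = 0 and L = L])
      show "((\<lambda>t. \<phi> (t + T)) has_vector_derivative ?s (\<phi> (t + T))) (at t)" for t
        using \<phi>[of "t + T"] by (simp add: DERIV_shift has_real_derivative_iff_has_vector_derivative[symmetric])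
      show "((\<lambda>t. \<phi> t + 2 * pi) has_vector_derivative ?s (\<phi> t + 2 * pi)) (at t)" for t
        unfolding per has_real_derivative_iff_has_vector_derivative[symmetric]
        using \<phi>[of t] by (auto intro!: derivative_eq_intros)
      show "norm (?s (\<phi> (t + T)) - ?s (\<phi> t + 2 * pi)) \<le> L * norm (\<phi> (t + T) - (\<phi> t + 2 * pi))" for t
        using L[of "\<phi> (t + T)" "\<phi> t + 2 * pi"] by simp
    qed (simp add: T \<phi>0)
  qed
  have \<gamma>per: "\<gamma> (t + T) = \<gamma> t" for t by (simp add: \<gamma>_def \<phi>T pt_per)
  have "\<exists>s t. \<gamma> s \<noteq> \<gamma> t"
  proof -
    obtain s where s: "\<phi> s = pi" using surj by blast
    have "\<gamma> 0 $ 1 > 0" using m \<rho>r[of 0] by (simp add: \<gamma>_def \<phi>0 pt_def polar_point_def)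
    moreover have "\<gamma> s $ 1 < 0" using m \<rho>r[of pi] by (simp add: \<gamma>_def s pt_def polar_point_def)
    ultimately have "\<gamma> 0 \<noteq> \<gamma> s" by force
    then show ?thesis by blast
  qed
  then have orbit: "periodic_orbit ?f \<Gamma>"
    unfolding periodic_orbit_def using \<gamma> \<gamma>per \<open>T > 0\<close> \<Gamma>_def by blast
  have compact: "compact \<Gamma>" unfolding \<Gamma>_def periodic_range[of \<gamma> T, OF \<gamma>per \<open>T > 0\<close>]
    by (intro compact_continuous_image continuous_on_subset[OF solves_on_continuous[OF \<gamma>]]) auto
  \<comment> \<open>The angle is not a continuous function of the point in the plane. Writing the
    energy in Cartesian coordinates makes the set \<open>U\<close> of admissible starting points
    open, and compactness of the orbit then gives a uniform tube inside it.\<close>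
  define E where "E z = averaged_energy a b m (z $ 1 / m) (z $ 2 / m)" for z :: "real^2"
  define U where "U = {z. 3/2 * m < norm z} \<inter> {z. norm z < 3 * m} \<inter> {z. 7/5 < E z} \<inter> {z. E z < 31/10}"
  have E_pt: "E (polar_point m r p) = polar_energy a b m p r" for r p
    using m by (simp add: E_def polar_point_def polar_energy_def)
  have "continuous_on UNIV E"
    unfolding E_def averaged_energy_def energy_tail_def corrector_def
    using m by (intro continuous_intros) auto
  then have "open U" unfolding U_def
    by (intro open_Int open_Collect_less continuous_intros) (auto intro: continuous_on_subset)
  moreover have "\<Gamma> \<subseteq> U"
  proof -
    have "pt p \<in> U" for p
      using \<rho>r[of p] \<rho>V[of p] m norm_polar_point[of m "\<rho> p" p] by (auto simp: U_def pt_def E_pt)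
    then show ?thesis by (auto simp: \<Gamma>_def \<gamma>_def)
  qed
  ultimately obtain \<delta> where \<delta>: "\<delta> > 0" "(\<Union>x\<in>\<Gamma>. ball x \<delta>) \<subseteq> U"
    using compact_subset_open_imp_ball_epsilon_subset[OF compact] by metis
  have attr: "\<exists>\<eta>. forward_solution ?f q \<eta> \<and> ((\<lambda>t. infdist (\<eta> t) \<Gamma>) \<longlongrightarrow> 0) at_top" if q: "infdist q \<Gamma> < \<delta>" for q
  proof -
    have "\<Gamma> \<noteq> {}" by (simp add: \<Gamma>_def)
    then obtain x where "x \<in> \<Gamma>" "infdist q \<Gamma> = dist q x"
      using infdist_attains_inf[OF compact_imp_closed[OF compact]] by metis
    then have "q \<in> ball x \<delta>" using q by (simp add: dist_commute)
    then have qU: "q \<in> U" using \<delta>(2) \<open>x \<in> \<Gamma>\<close> by blast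
    define r where "r = norm q / m"
    have r: "r \<in> {3/2..3}" using qU m by (auto simp: U_def r_def field_simps)
    have "q \<noteq> 0" using qU m by (auto simp: U_def)
    then obtain p0 where p0: "q = polar_point m r p0" using polar_point_exists[OF m] unfolding r_def by blast
    have V0: "polar_energy a b m p0 r \<in> {7/5..31/10}" using qU E_pt[of r p0] p0 by (auto simp: U_def)
    obtain \<sigma> where \<sigma>: "sol \<sigma>" "\<sigma> p0 = r" using sol_exists by blast
    obtain \<psi> where \<psi>0: "\<psi> 0 = p0" and
      \<psi>: "\<And>t. (\<psi> has_real_derivative polar_speed a b m (\<psi> t) (clamp_radius (\<sigma> (\<psi> t)))) (at t)"
      using phase[OF \<sigma>(1), of p0] by blast
    have \<psi>gr: "\<psi> t \<ge> p0 + t / 2" if "t \<ge> 0" for t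
      using growth_at_least_half[OF \<psi> speed[OF clamp_radius_mem] that] \<psi>0 by simp
    define c where "c = \<bar>polar_energy a b m p0 r - polar_energy a b m p0 (\<rho> p0)\<bar>"
    have at: "\<sigma> p \<in> {3/2<..<3}" "\<bar>\<sigma> p - \<rho> p\<bar> \<le> exp (- (\<kappa> / 4) * (p - p0)) * c" if "p \<ge> p0" for p
      using attraction[OF \<rho>(1) \<rho>r' \<sigma>(1) _ _ that] r V0 unfolding c_def \<sigma>(2) by blast+
    define \<eta> where "\<eta> t = polar_point m (\<sigma> (\<psi> t)) (\<psi> t)" for t
    have "forward_solution ?f q \<eta>"
      unfolding forward_solution_def solves_on_def
    proof (intro conjI ballI)
      show "\<eta> 0 = q" by (simp add: \<eta>_def \<psi>0 \<sigma>(2) p0)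
      fix t :: real assume "t \<in> {0..}"
      then have "\<sigma> (\<psi> t) \<in> {3/2<..<3}" using \<psi>gr[of t] by (intro at) auto
      then have "\<sigma> (\<psi> t) \<in> {3/2..3}" by simp
      from curve[OF \<sigma>(1) \<psi> this] show "(\<eta> has_vector_derivative ?f (\<eta> t)) (at t within {0..})"
        by (simp add: \<eta>_def[abs_def])
    qed
    moreover have "((\<lambda>t. infdist (\<eta> t) \<Gamma>) \<longlongrightarrow> 0) at_top"
    proof (rule tendsto_sandwich[of "\<lambda>_. 0" _ _ "\<lambda>t. m * (exp (- (\<kappa> / 8) * t) * c)"])
      show "\<forall>\<^sub>F t in at_top. infdist (\<eta> t) \<Gamma> \<le> m * (exp (- (\<kappa> / 8) * t) * c)"
        using eventually_ge_at_top[of 0]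
      proof eventually_elim
        case (elim t)
        have "p0 \<le> \<psi> t" using \<psi>gr[OF elim] elim by simp
        \<comment> \<open>The point of the orbit used for comparison is the one at the same angle,
          not the one at the same time.\<close>
        have "infdist (\<eta> t) \<Gamma> \<le> dist (\<eta> t) (pt (\<psi> t))" by (rule infdist_le[OF pt_\<Gamma>])
        also have "\<dots> = m * \<bar>\<sigma> (\<psi> t) - \<rho> (\<psi> t)\<bar>" using m by (simp add: \<eta>_def pt_def dist_polar_point)
        also have "\<dots> \<le> m * (exp (- (\<kappa> / 4) * (\<psi> t - p0)) * c)"
          using m at(2)[OF \<open>p0 \<le> \<psi> t\<close>] by (intro mult_left_mono) auto
        also have "\<dots> \<le> m * (exp (- (\<kappa> / 8) * t) * c)"
        proof -
          \<comment> \<open>The angle advances at rate at least 1/2, so the decay rate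
            \<open>\<kappa> / 4\<close> in the angle becomes \<open>\<kappa> / 8\<close> in
            time.\<close>
          have "(\<kappa> / 4) * (t / 2) \<le> (\<kappa> / 4) * (\<psi> t - p0)" using \<psi>gr[OF elim] \<kappa> by (intro mult_left_mono) auto
          then have "exp (- (\<kappa> / 4) * (\<psi> t - p0)) \<le> exp (- (\<kappa> / 8) * t)" by simp
          then show ?thesis using m by (intro mult_left_mono mult_right_mono) (auto simp: c_def)
        qed
        finally show ?case .
      qed
      have "filterlim (\<lambda>t. - (\<kappa> / 8) * t) at_bot at_top"
        using \<kappa> by (intro filterlim_tendsto_neg_mult_at_bot[OF tendsto_const] filterlim_ident) auto
      then have "((\<lambda>t. exp (- (\<kappa> / 8) * t)) \<longlongrightarrow> 0) at_top" by (rule filterlim_compose[OF exp_at_bot])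
      from tendsto_mult_left[OF tendsto_mult_right[OF this], of m c]
      show "((\<lambda>t. m * (exp (- (\<kappa> / 8) * t) * c)) \<longlongrightarrow> 0) at_top" by simp
    qed (auto simp: infdist_nonneg)
    ultimately show ?thesis by blast
  qed
  have "stable_limit_cycle ?f \<Gamma>"
  proof (rule attracting_orbit_limit_cycle[OF cubic_field_lipschitz orbit \<delta>(1)], intro conjI allI impI)
    fix q assume q: "infdist q \<Gamma> < \<delta>"
    obtain \<eta> where \<eta>: "forward_solution ?f q \<eta>" "((\<lambda>t. infdist (\<eta> t) \<Gamma>) \<longlongrightarrow> 0) at_top"
      using attr[OF q] by blast
    then show "\<exists>\<eta>. forward_solution ?f q \<eta>" by blast
    fix \<zeta> assume \<zeta>: "forward_solution ?f q \<zeta>"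
    \<comment> \<open>The attraction was shown for one constructed solution; forward uniqueness
      carries it over to every forward solution from the same point.\<close>
    have "\<forall>\<^sub>F t in at_top. infdist (\<eta> t) \<Gamma> = infdist (\<zeta> t) \<Gamma>"
      using eventually_ge_at_top[of 0]
    proof eventually_elim
      case (elim t)
      have "\<eta> t = \<zeta> t"
        using cubic_forward_unique[of a b "m\<^sup>2" \<eta> \<zeta> t] \<eta>(1) \<zeta> elim by (simp add: forward_solution_def)
      then show ?case by simp
    qed
    then show "((\<lambda>t. infdist (\<zeta> t) \<Gamma>) \<longlongrightarrow> 0) at_top" using \<eta>(2) by (rule Lim_transform_eventually[rotated])
  qed
  then show ?thesis by blast
qed

theorem theorem2p2:
  fixes d e :: real
  assumes "d \<noteq> 0" and "e \<noteq> 0" and "\<bar>d\<bar> \<le> \<bar>e\<bar>" and "d \<noteq> e"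
  shows "(\<forall>\<theta>. (\<theta> > 0 \<longrightarrow> unstable_equilibrium (vdp_field d e \<theta>) 0) \<and>
              (\<theta> \<le> 0 \<longrightarrow> stable_equilibrium (vdp_field d e \<theta>) 0)) \<and>
         (\<exists>\<epsilon>>0. \<forall>\<theta>\<in>{-\<epsilon><..<\<epsilon>}. source (vdp_field d e \<theta>) 0 \<longrightarrow>
              (\<exists>\<Gamma>. stable_limit_cycle (vdp_field d e \<theta>) \<Gamma>))"
proof -
  define a b where "a = 1 / d + 1 / e" and "b = 1 / (d * e)"
  have vdp: "vdp_field d e \<theta> = cubic_field a b \<theta>" for \<theta>
    using vdp_field_eq_cubic[OF assms(1,2)] by (simp add: a_def b_def)
  have eq: "equilibrium (cubic_field a b \<theta>) 0" for \<theta>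
    by (simp add: equilibrium_def cubic_field_def vec_eq_iff forall_2)
  obtain m0 where m0: "m0 > 0" and hopf: "\<And>m. 0 < m \<Longrightarrow> m < m0 \<Longrightarrow>
      annular_ode (polar_slope a b m) (polar_energy a b m) (polar_energy_rate a b m) (m\<^sup>2 / 8) \<and>
      (\<forall>p. \<forall>r\<in>{3/2..3}. polar_speed a b m p r \<ge> 1/2)"
    using annular_ode_polar[of a b] by blast
  \<comment> \<open>The bound 1 serves the eigenvalue argument, which turns the source condition
    into \<open>\<theta> > 0\<close>; the bound \<open>m0\<^sup>2\<close> makes m = sqrt theta
    admissible.\<close>
  have "\<exists>\<Gamma>. stable_limit_cycle (cubic_field a b \<theta>) \<Gamma>"
    if \<theta>: "\<theta> \<in> {- min 1 (m0\<^sup>2)<..<min 1 (m0\<^sup>2)}" and src: "source (cubic_field a b \<theta>) 0" for \<theta>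
  proof -
    have pos: "\<theta> > 0" using source_imp_pos[OF src] \<theta> by auto
    then have "sqrt \<theta> > 0" "sqrt \<theta> < m0" using \<theta> m0 by (auto intro: real_less_lsqrt)
    from hopf_limit_cycle[OF this(1)] hopf[OF this] have "\<exists>\<Gamma>. stable_limit_cycle (cubic_field a b ((sqrt \<theta>)\<^sup>2)) \<Gamma>"
      by blast
    then show ?thesis using pos by simp
  qed
  moreover have "min 1 (m0\<^sup>2) > 0" using m0 by simp
  ultimately show ?thesis
    unfolding vdp unstable_equilibrium_def stable_equilibrium_def
    using eq positive_unstable nonpositive_stable by blast
qed

end
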